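(* Let $M_t, M_r, T\ge 1$ be integers. Consider the $K$-user $M_t\times M_r$ MIMO interference channel with $T$ independent channel extensions, i.e. all the channel coefficients $H_{kj}^l(p,q)$ ($1\le l\le T$, $1\le p\le M_r$, $1\le q\le M_t$, $k,j$ ranging over users) are drawn independently from (possibly different) continuous distributions on $\mathbb{C}$. Suppose each user transmits a single data stream. Then the following hold with probability one: (a) If a single-beam vector space IA scheme exists for the $K$-user channel, then $K\le (M_r+M_t)T-1$. (b) If $K=(M_r+M_t-1)T$, then a single-beam vector space IA scheme exists for the $K$-user channel. (c) The maximum DoF achievable via vector space IA in the single-beam case is no more than $M_r+M_t$ and no less than $M_r+M_t-1$.
   Context: The channel matrix from transmitter $j$ to receiver $k$ is the $M_rT\times M_tT$ block diagonal matrix $H_{kj}=\mathrm{diag}(H_{kj}^1,\dots,H_{kj}^T)$, where each block $H_{kj}^l$ is an $M_r\times M_t$ complex matrix with entries $H_{kj}^l(p,q)$; off-diagonal blocks are zero. The $K$-user channel is the collection $(H_{kj})_{1\le k,j\le K}$. A single-beam vector space interference alignment (IA) scheme for the $K$-user channel is a choice of vectors $v_k\in\mathbb{C}^{M_tT}$ and $u_k\in\mathbb{C}^{M_rT}$, $1\le k\le K$, such that $u_k^H H_{kj}v_j=0$ for all $1\le k\ne j\le K$, and $u_k^H H_{kk}v_k\neq 0$ for all $1\le k\le K$, where $(\cdot)^H$ is the conjugate transpose. The degrees of freedom (DoF) achieved by such a scheme is (total number of data streams)/(number of channel uses) $=K/T$. The maximum DoF achievable in the single-beam case is the maximum of $K/T$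 over all $K\geq 1$ for which a single-beam vector space IA scheme exists for the $K$-user channel (the coefficients being drawn for all pairs of users $k,j\ge 1$, the $K$-user channel consisting of the first $K$ users). "Continuous distribution on $\mathbb{C}$" means absolutely continuous with respect to Lebesgue measure on $\mathbb{C}\cong\mathbb{R}^2$. *)

theory Defs
  imports "HOL-Probability.Probability" "Jordan_Normal_Form.Conjugate" "Jordan_Normal_Form.Matrix"
begin

(* Users, channel extensions and antennas are numbered from 0; the K-user channel consists of
   the users 0, ..., K - 1.  The matrix entry h l p q is the coefficient from transmit antenna q
   to receive antenna p in the channel extension l. *)

definition channel_matrix ::
  "nat \<Rightarrow> nat \<Rightarrow> nat \<Rightarrow> (nat \<Rightarrow> nat \<Rightarrow> nat \<Rightarrow> complex) \<Rightarrow> complex Matrix.mat" where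
  "channel_matrix Mr Mt T h =
     diag_block_mat (map (\<lambda>l. Matrix.mat Mr Mt (\<lambda>(p, q). h l p q)) [0..<T])"

lemma channel_matrix_carrier: "channel_matrix Mr Mt T h \<in> carrier_mat (Mr * T) (Mt * T)"
  by (rule carrier_matI)
    (simp_all add: channel_matrix_def dim_diag_block_mat o_def sum_list_triv mult.commute)

(* scalar_prod is bilinear, so scalar_prod (conjugate u) w is u^H w. *)

definition single_beam_IA_scheme ::
  "nat \<Rightarrow> nat \<Rightarrow> nat \<Rightarrow> (nat \<Rightarrow> nat \<Rightarrow> complex Matrix.mat) \<Rightarrow> nat
    \<Rightarrow> (nat \<Rightarrow> complex Matrix.vec) \<Rightarrow> (nat \<Rightarrow> complex Matrix.vec) \<Rightarrow> bool" where
  "single_beam_IA_scheme Mr Mt T H K v u \<longleftrightarrow>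
     (\<forall>k<K. v k \<in> carrier_vec (Mt * T)) \<and>
     (\<forall>k<K. u k \<in> carrier_vec (Mr * T)) \<and>
     (\<forall>k<K. \<forall>j<K. k \<noteq> j \<longrightarrow> scalar_prod (conjugate (u k)) (H k j *\<^sub>v v j) = 0) \<and>
     (\<forall>k<K. scalar_prod (conjugate (u k)) (H k k *\<^sub>v v k) \<noteq> 0)"

definition single_beam_feasible ::
  "nat \<Rightarrow> nat \<Rightarrow> nat \<Rightarrow> (nat \<Rightarrow> nat \<Rightarrow> complex Matrix.mat) \<Rightarrow> nat \<Rightarrow> bool" where
  "single_beam_feasible Mr Mt T H K \<longleftrightarrow> (\<exists>v u. single_beam_IA_scheme Mr Mt T H K v u)"

definition achievable_dofs ::
  "nat \<Rightarrow> nat \<Rightarrow> nat \<Rightarrow> (nat \<Rightarrow> nat \<Rightarrow> complex Matrix.mat) \<Rightarrow> real set" where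
  "achievable_dofs Mr Mt T H =
     {real K / real T |K. 1 \<le> K \<and> single_beam_feasible Mr Mt T H K}"

(* Max is meaningful only for finite nonempty sets, so any claim about max_dof has to be
   accompanied by finiteness and nonemptiness of achievable_dofs. *)

definition max_dof ::
  "nat \<Rightarrow> nat \<Rightarrow> nat \<Rightarrow> (nat \<Rightarrow> nat \<Rightarrow> complex Matrix.mat) \<Rightarrow> real" where
  "max_dof Mr Mt T H = Max (achievable_dofs Mr Mt T H)"

end

theory Submission
  imports Defs "HOL-Computational_Algebra.Fundamental_Theorem_Algebra"
begin

text \<open>
  Almost surely the channel coefficients are algebraically independent over the integers, and
  all three claims hold for every algebraically independent channel.

  For the upper bound, a scheme with too many users would express the coefficients rationally
  through fewer numbers (some of the coefficients, and the beam coordinates), which is impossible by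
  counting monomials. Blocks on which some beams vanish are handled by induction on the set of blocks.

  For the lower bound, the users are split into \<open>T\<close> groups of \<open>Mr + Mt - 1\<close>, each group using its own
  block. Within a block the alignment equations are solved by power series along the line from a
  special channel to the given one. By algebraic independence the channel on the formal line and the
  given channel satisfy the same integer polynomial relations, so the solution over power series can
  be transferred to the complex numbers one coordinate at a time.
\<close>

section \<open>Integer polynomial relations\<close>

text \<open>Both bounds come from one count. If every beam meets every block, \<open>K\<close> users
  impose \<open>K * (K - 1)\<close> equations on \<open>K * (Mr * T - 1) + K * (Mt * T - 1)\<close>
  free coordinates, each beam losing one to scaling. Solvability for generic coefficients then
  forces \<open>K \<le> (Mr + Mt) * T - 1\<close>. The obstacle to this plain count is that beams
  may avoid blocks, which makes some equations void. For \<open>T = 1\<close> and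
  \<open>K = Mr + Mt - 1\<close> equations and unknowns balance, so one can look for an iteration in
  which each equation determines one unknown.\<close>

datatype (pvars: 'v) poly_expr =
    PVar 'v | PConst int | PAdd "'v poly_expr" "'v poly_expr" | PMul "'v poly_expr" "'v poly_expr"
  for map: pmap

text \<open>Countability is the reason for integer coefficients: exceptional null sets can be united
  over all relations, and the values of expressions form a countable ring, which leaves room for
  transcendental complex numbers.\<close>

instance poly_expr :: (countable) countable
  by countable_datatype

text \<open>The same expression is evaluated in complex numbers, polynomials and power series, which
  makes relations comparable across these rings.\<close>

primrec peval :: "('v \<Rightarrow> 'a::comm_ring_1) \<Rightarrow> 'v poly_expr \<Rightarrow> 'a" where
  "peval x (PVar i) = x i"
| "peval x (PConst n) = of_int n"
| "peval x (PAdd P Q) = peval x P + peval x Q"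
| "peval x (PMul P Q) = peval x P * peval x Q"

lemma peval_cong: "(\<And>i. i \<in> pvars P \<Longrightarrow> x i = y i) \<Longrightarrow> peval x P = peval y P"
  by (induction P) auto

lemma peval_pmap: "peval x (pmap f P) = peval (\<lambda>i. x (f i)) P"
  by (induction P) auto

lemma peval_hom:
  assumes "\<And>a b. f (a + b) = f a + f b" "\<And>a b. f (a * b) = f a * f b"
    and "\<And>n. f (of_int n) = of_int n"
  shows "peval (\<lambda>i. f (x i)) P = f (peval x P)"
  by (induction P) (simp_all add: assms)

text \<open>Triviality of a relation is judged by its values at complex points, because
  syntactically different expressions may denote the same polynomial.\<close>

definition alg_indep :: "'v set \<Rightarrow> ('v \<Rightarrow> complex) \<Rightarrow> bool" where
  "alg_indep V x \<longleftrightarrow>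
     (\<forall>P. pvars P \<subseteq> V \<longrightarrow> peval x P = 0 \<longrightarrow> (\<forall>z::'v \<Rightarrow> complex. peval z P = 0))"

lemma alg_indepD:
  "alg_indep V x \<Longrightarrow> pvars P \<subseteq> V \<Longrightarrow> peval x P = 0 \<Longrightarrow> peval (z :: _ \<Rightarrow> complex) P = 0"
  unfolding alg_indep_def by blast

lemma alg_indep_reindex:
  assumes "alg_indep V x" "inj_on f W" "f ` W \<subseteq> V"
  shows "alg_indep W (\<lambda>i. x (f i))"
  unfolding alg_indep_def
proof (intro allI impI)
  fix P and z :: "_ \<Rightarrow> complex"
  assume P: "pvars P \<subseteq> W" "peval (\<lambda>i. x (f i)) P = 0"
  have "peval x (pmap f P) = 0" using P by (simp add: peval_pmap)
  moreover have "pvars (pmap f P) \<subseteq> V" using P(1) assms(3) by (auto simp: poly_expr.set_map)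
  ultimately have "peval (\<lambda>j. z (inv_into W f j)) (pmap f P) = 0"
    using alg_indepD[OF assms(1)] by blast
  moreover have "peval (\<lambda>j. z (inv_into W f j)) (pmap f P) = peval z P"
    unfolding peval_pmap using P(1) assms(2) by (intro peval_cong) (auto simp: subset_iff)
  ultimately show "peval z P = 0" by simp
qed

lemma Poly_map_coeff: "degree p = n \<Longrightarrow> Poly (map (coeff p) [0..<Suc n]) = p"
  by (intro poly_eqI) (auto simp: coeff_Poly_eq nth_default_def coeff_eq_0 simp del: upt_Suc)

text \<open>The graph \<open>G\<close> of an isomorphism between a countable subring of an integral domain and a subring
  of the complex numbers. Adjoining any element of the domain, one finds a matching complex number:
  a root of the image of the minimal polynomial in the algebraic case, and a number avoiding
  countably many roots in the transcendental case.\<close>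

locale partial_ring_iso =
  fixes G :: "('a::idom \<times> complex) set"
  assumes of_int_mem: "(of_int n, of_int n) \<in> G"
    and add_mem: "(a, b) \<in> G \<Longrightarrow> (a', b') \<in> G \<Longrightarrow> (a + a', b + b') \<in> G"
    and mult_mem: "(a, b) \<in> G \<Longrightarrow> (a', b') \<in> G \<Longrightarrow> (a * a', b * b') \<in> G"
    and zero_iff: "(a, b) \<in> G \<Longrightarrow> a = 0 \<longleftrightarrow> b = 0"
    and countable_G: "countable G"
begin

lemma zero_mem: "(0, 0) \<in> G" and one_mem: "(1, 1) \<in> G"
  using of_int_mem[of 0] of_int_mem[of 1] by simp_all

lemma uminus_mem: "(a, b) \<in> G \<Longrightarrow> (- a, - b) \<in> G"
  using mult_mem[OF of_int_mem[of "-1"], of a b] by simp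

lemma sum_mem: "finite A \<Longrightarrow> (\<And>i. i \<in> A \<Longrightarrow> (f i, g i) \<in> G) \<Longrightarrow> (sum f A, sum g A) \<in> G"
  by (induction A rule: finite_induct) (auto intro: zero_mem add_mem)

text \<open>Applied to differences, \<open>zero_iff\<close> shows that \<open>G\<close> is the graph
  of an injective map; \<open>polys\<close> is the graph of its coefficientwise extension to
  polynomials.\<close>

definition polys :: "('a poly \<times> complex poly) set" where
  "polys = {(p, q). \<forall>n. (coeff p n, coeff q n) \<in> G}"

lemma polys_coeff: "(p, q) \<in> polys \<Longrightarrow> (coeff p n, coeff q n) \<in> G"
  by (simp add: polys_def)

lemma polys_zero: "(0, 0) \<in> polys"
  by (simp add: polys_def zero_mem)

lemma polys_add: "(p, q) \<in> polys \<Longrightarrow> (p', q') \<in> polys \<Longrightarrow> (p + p', q + q') \<in> polys"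
  by (simp add: polys_def add_mem)

lemma polys_diff: "(p, q) \<in> polys \<Longrightarrow> (p', q') \<in> polys \<Longrightarrow> (p - p', q - q') \<in> polys"
  using add_mem[OF _ uminus_mem] by (fastforce simp: polys_def)

lemma polys_smult: "(a, b) \<in> G \<Longrightarrow> (p, q) \<in> polys \<Longrightarrow> (Polynomial.smult a p, Polynomial.smult b q) \<in> polys"
  by (simp add: polys_def mult_mem)

lemma polys_mult: "(p, q) \<in> polys \<Longrightarrow> (p', q') \<in> polys \<Longrightarrow> (p * p', q * q') \<in> polys"
  unfolding polys_def by (auto simp: coeff_mult intro!: sum_mem mult_mem)

lemma polys_monom: "(a, b) \<in> G \<Longrightarrow> (monom a n, monom b n) \<in> polys"
  by (simp add: polys_def zero_mem)

lemma polys_zero_iff: "(p, q) \<in> polys \<Longrightarrow> p = 0 \<longleftrightarrow> q = 0"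
  unfolding polys_def using zero_iff by (auto simp: poly_eq_iff)

lemma polys_degree: 
  assumes "(p, q) \<in> polys" shows "degree p = degree q"
proof -
  have "coeff p n = 0 \<longleftrightarrow> coeff q n = 0" for n
    using polys_coeff[OF assms] zero_iff by blast
  then show ?thesis by (simp add: degree_def)
qed

text \<open>Leading coefficients need not be invertible, so division is preceded by multiplication
  with a nonzero element. Each round cancels the leading term of \<open>p\<close> against a multiple
  of \<open>m\<close>; doing the same to the partners keeps quotients and remainders
  matched.\<close>

lemma pseudo_division:
  assumes m: "(m, m') \<in> polys" "m \<noteq> 0" and p: "(p, q) \<in> polys"
  shows "\<exists>a b d d' r r'. (a, b) \<in> G \<and> a \<noteq> 0 \<and> (d, d') \<in> polys \<and> (r, r') \<in> polys \<and>
    Polynomial.smult a p = m * d + r \<and> Polynomial.smult b q = m' * d' + r' \<and> (r = 0 \<or> degree r < degree m)"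
  using p
proof (induction "degree p" arbitrary: p q rule: less_induct)
  case less
  show ?case
  proof (cases "p = 0 \<or> degree p < degree m")
    case True
    show ?thesis
      by (intro exI[of _ 1] exI[of _ 1] exI[of _ 0] exI[of _ 0] exI[of _ p] exI[of _ q])
        (use True less.prems in \<open>auto simp: one_mem polys_zero\<close>)
  next
    case False
    define n where "n = degree p - degree m"
    define e e' where "e = monom (lead_coeff p) n" and "e' = monom (lead_coeff q) n"
    define p1 q1 where "p1 = Polynomial.smult (lead_coeff m) p - m * e" and "q1 = Polynomial.smult (lead_coeff m') q - m' * e'"
    have e: "(e, e') \<in> polys" unfolding e_def e'_def
      using polys_monom[OF polys_coeff[OF less.prems, of "degree p"]] polys_degree[OF less.prems] by simp
    have lm: "(lead_coeff m, lead_coeff m') \<in> G"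
      using polys_coeff[OF m(1), of "degree m"] polys_degree[OF m(1)] by simp
    have p1: "(p1, q1) \<in> polys" unfolding p1_def q1_def
      by (intro polys_diff polys_smult polys_mult lm less.prems m(1) e)
    have deg_e: "degree e = n" and e0: "e \<noteq> 0" using False by (auto simp: e_def degree_monom_eq)
    have "degree (m * e) = degree p" using m(2) e0 deg_e False by (simp add: degree_mult_eq n_def)
    then have le: "degree p1 \<le> degree p" unfolding p1_def
      by (intro degree_diff_le) auto
    have "coeff (m * e) (degree p) = lead_coeff m * lead_coeff e"
      using coeff_mult_degree_sum[of m e] deg_e False by (simp add: n_def)
    then have "coeff p1 (degree p) = 0"
      unfolding p1_def using False by (simp add: e_def degree_monom_eq)
    then have lt: "p1 = 0 \<or> degree p1 < degree p"
      using le by (metis le_neq_implies_less leading_coeff_0_iff)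
    have "\<exists>a b d d' r r'. (a, b) \<in> G \<and> a \<noteq> 0 \<and> (d, d') \<in> polys \<and> (r, r') \<in> polys \<and>
      Polynomial.smult a p1 = m * d + r \<and> Polynomial.smult b q1 = m' * d' + r' \<and> (r = 0 \<or> degree r < degree m)"
    proof (cases "p1 = 0")
      case True
      then have "q1 = 0" using polys_zero_iff p1 by blast
      show ?thesis
        by (intro exI[of _ 1] exI[of _ 1] exI[of _ 0] exI[of _ 0] exI[of _ 0] exI[of _ 0])
          (use True \<open>q1 = 0\<close> in \<open>auto simp: one_mem polys_zero\<close>)
    next
      case False
      then show ?thesis using less.hyps[OF _ p1] lt by blast
    qed
    then obtain a b d d' r r' where *: "(a, b) \<in> G" "a \<noteq> 0" "(d, d') \<in> polys" "(r, r') \<in> polys"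
      "Polynomial.smult a p1 = m * d + r" "Polynomial.smult b q1 = m' * d' + r'" "r = 0 \<or> degree r < degree m"
      by blast
    show ?thesis
    proof (intro exI conjI)
      show "(a * lead_coeff m, b * lead_coeff m') \<in> G" by (intro mult_mem * lm)
      show "a * lead_coeff m \<noteq> 0" using * m by simp
      show "(d + Polynomial.smult a e, d' + Polynomial.smult b e') \<in> polys" by (intro polys_add polys_smult * e)
      show "(r, r') \<in> polys" by fact
      show "Polynomial.smult (a * lead_coeff m) p = m * (d + Polynomial.smult a e) + r"
        using *(5) unfolding p1_def by (simp add: smult_diff_right algebra_simps)
      show "Polynomial.smult (b * lead_coeff m') q = m' * (d' + Polynomial.smult b e') + r'"
        using *(6) unfolding q1_def by (simp add: smult_diff_right algebra_simps)
      show "r = 0 \<or> degree r < degree m" by fact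
    qed
  qed
qed

text \<open>Matched polynomials have equal degree, so a pair is encoded by one finite list of
  elements of \<open>G\<close>.\<close>

lemma countable_polys: "countable polys"
proof -
  have "polys \<subseteq> (\<lambda>xs. (Poly (map fst xs), Poly (map snd xs))) ` lists G"
  proof
    fix x assume "x \<in> polys"
    obtain p q where x: "x = (p, q)" "(p, q) \<in> polys" using \<open>x \<in> polys\<close> by (cases x) auto
    define xs where "xs = map (\<lambda>n. (coeff p n, coeff q n)) [0..<Suc (degree p)]"
    have "map fst xs = map (coeff p) [0..<Suc (degree p)]" "map snd xs = map (coeff q) [0..<Suc (degree p)]"
      unfolding xs_def map_map o_def by simp_all
    then have "x = (Poly (map fst xs), Poly (map snd xs))"
      using x(1) Poly_map_coeff[OF refl, of p] Poly_map_coeff[OF polys_degree[OF x(2), symmetric]]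
      by (simp only:)
    moreover have "xs \<in> lists G" unfolding xs_def in_lists_conv_set using polys_coeff[OF x(2)] by auto
    ultimately show "x \<in> (\<lambda>xs. (Poly (map fst xs), Poly (map snd xs))) ` lists G" by blast
  qed
  then show ?thesis by (rule countable_subset) (intro countable_image countable_lists countable_G)
qed

lemma extend_transcendental:
  assumes "\<And>p q. (p, q) \<in> polys \<Longrightarrow> poly p t = 0 \<Longrightarrow> p = 0"
  shows "\<exists>s. \<forall>(p, q)\<in>polys. poly p t = 0 \<longleftrightarrow> poly q s = 0"
proof -
  define Z where "Z = (\<Union>x\<in>{x\<in>polys. snd x \<noteq> 0}. {s. poly (snd x) s = 0})"
  have "countable Z" unfolding Z_def
    by (intro countable_UN countable_subset[OF _ countable_polys] countable_finite poly_roots_finite) auto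
  then obtain s where s: "s \<notin> Z" using uncountable_UNIV_complex
    by (metis UNIV_I countable_subset subsetI)
  have "poly p t = 0 \<longleftrightarrow> poly q s = 0" if pq: "(p, q) \<in> polys" for p q
  proof
    assume "poly p t = 0"
    then have "p = 0" using assms pq by blast
    then show "poly q s = 0" using polys_zero_iff pq by auto
  next
    assume "poly q s = 0"
    then have "q = 0" using s pq unfolding Z_def by force
    then have "p = 0" using polys_zero_iff pq by blast
    then show "poly p t = 0" by simp
  qed
  then show ?thesis by blast
qed

text \<open>Let \<open>m\<close> have minimal degree among the matched nonzero polynomials vanishing
  at \<open>t\<close>. Any root \<open>s\<close> of its partner \<open>m'\<close> serves: relations
  of \<open>t\<close> pass to \<open>s\<close> because they are pseudo-multiples of
  \<open>m\<close>, and the converse reflects that \<open>m\<close> has no proper factor.\<close>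

lemma extend_algebraic:
  assumes "(p0, q0) \<in> polys" "poly p0 t = 0" "p0 \<noteq> 0"
  shows "\<exists>s. \<forall>(p, q)\<in>polys. poly p t = 0 \<longleftrightarrow> poly q s = 0"
proof -
  define Z where "Z = (\<lambda>n. \<exists>p q. (p, q) \<in> polys \<and> poly p t = 0 \<and> p \<noteq> 0 \<and> degree p = n)"
  have "Z (LEAST n. Z n)" by (rule LeastI[of Z "degree p0"]) (use assms in \<open>auto simp: Z_def\<close>)
  then obtain m m' where m: "(m, m') \<in> polys" "poly m t = 0" "m \<noteq> 0" and deg_m: "degree m = (LEAST n. Z n)"
    unfolding Z_def by blast
  have min: "p = 0" if "(p, q) \<in> polys" "poly p t = 0" "degree p < degree m" for p q
    using not_less_Least[of "degree p" Z] that deg_m unfolding Z_def by auto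
  have "degree m \<noteq> 0"
  proof
    assume "degree m = 0"
    then obtain c where "m = [:c:]" by (metis degree_eq_zeroE)
    then show False using m by simp
  qed
  then have "degree m' \<noteq> 0" using polys_degree m by simp
  then obtain s where s: "poly m' s = 0"
    using fundamental_theorem_of_algebra[of m'] constant_degree by metis
  have sound: "poly q s = 0" if pq: "(p, q) \<in> polys" "poly p t = 0" for p q
  proof -
    obtain a b d d' r r' where *: "(a, b) \<in> G" "a \<noteq> 0" "(d, d') \<in> polys" "(r, r') \<in> polys"
      "Polynomial.smult a p = m * d + r" "Polynomial.smult b q = m' * d' + r'" "r = 0 \<or> degree r < degree m"
      using pseudo_division[OF m(1) m(3) pq(1)] by blast
    have "poly r t = 0" using arg_cong[OF *(5), of "\<lambda>u. poly u t"] pq(2) m(2) by simp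
    then have "r = 0" using min[OF *(4)] *(7) by blast
    then have "r' = 0" using *(4) polys_zero_iff by blast
    then have "b * poly q s = 0" using arg_cong[OF *(6), of "\<lambda>u. poly u s"] s by simp
    moreover have "b \<noteq> 0" using * zero_iff by blast
    ultimately show ?thesis by simp
  qed
  have complete: "poly p t = 0" if "(p, q) \<in> polys" "poly q s = 0" for p q
    using that
  proof (induction "degree p" arbitrary: p q rule: less_induct)
    case less
    show ?case
    proof (rule ccontr)
      assume pt: "poly p t \<noteq> 0"
      then have p0: "p \<noteq> 0" by auto
      have "degree p < degree m"
      proof (rule ccontr)
        assume ge: "\<not> degree p < degree m"
        obtain a b d d' r r' where *: "(a, b) \<in> G" "a \<noteq> 0" "(d, d') \<in> polys" "(r, r') \<in> polys"
          "Polynomial.smult a p = m * d + r" "Polynomial.smult b q = m' * d' + r'" "r = 0 \<or> degree r < degree m"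
          using pseudo_division[OF m(1) m(3) less.prems(1)] by blast
        have rt: "poly r t = a * poly p t" using arg_cong[OF *(5), of "\<lambda>u. poly u t"] m(2) by simp
        have "poly r' s = 0" using arg_cong[OF *(6), of "\<lambda>u. poly u s"] s less.prems(2) by simp
        moreover have "r \<noteq> 0" using rt *(2) pt by auto
        ultimately have "poly r t = 0" using less.hyps[OF _ *(4)] *(7) ge by force
        then show False using rt *(2) pt by simp
      qed
      \<comment> \<open>Now \<open>m\<close> is divided by \<open>p\<close>. The partner of the
        remainder vanishes at \<open>s\<close>, so by induction the remainder vanishes at
        \<open>t\<close> and is zero by minimality. Thus \<open>p\<close> divides a multiple of
        \<open>m\<close>; the cofactor \<open>d\<close> vanishes at \<open>t\<close>, so its degree
        is at least that of \<open>m\<close> and \<open>p\<close> is constant.\<close>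
      obtain a b d d' r r' where *: "(a, b) \<in> G" "a \<noteq> 0" "(d, d') \<in> polys" "(r, r') \<in> polys"
        "Polynomial.smult a m = p * d + r" "Polynomial.smult b m' = q * d' + r'" "r = 0 \<or> degree r < degree p"
        using pseudo_division[OF less.prems(1) p0 m(1)] by blast
      have "poly r' s = 0" using arg_cong[OF *(6), of "\<lambda>u. poly u s"] s less.prems(2) by simp
      then have "r = 0 \<or> poly r t = 0" using less.hyps[OF _ *(4)] *(7) by blast
      then have "r = 0" using min[OF *(4)] *(7) \<open>degree p < degree m\<close> by force
      then have eq: "Polynomial.smult a m = p * d" using * by simp
      have dt: "poly d t = 0" using arg_cong[OF eq, of "\<lambda>u. poly u t"] m(2) pt by simp
      have d0: "d \<noteq> 0" using eq m(3) *(2) by auto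
      have "degree m = degree p + degree d" using arg_cong[OF eq, of degree] *(2) p0 d0
        by (simp add: degree_mult_eq)
      then have "degree p = 0" using min[OF *(3) dt] d0 by force
      then have "degree q = 0" using polys_degree less.prems(1) by simp
      then obtain c where "q = [:c:]" by (metis degree_eq_zeroE)
      then have "q = 0" using less.prems(2) by simp
      then show False using p0 polys_zero_iff less.prems(1) by blast
    qed
  qed
  show ?thesis using sound complete by blast
qed

lemma extend: "\<exists>s. \<forall>(p, q)\<in>polys. poly p t = 0 \<longleftrightarrow> poly q s = 0"
  using extend_transcendental[of t] extend_algebraic[of _ _ t] by blast

end

section \<open>Transfer of relations to the complex numbers\<close>

definition same_relations :: "'v set \<Rightarrow> ('v \<Rightarrow> 'a::comm_ring_1) \<Rightarrow> ('v \<Rightarrow> complex) \<Rightarrow> bool" where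
  "same_relations V a c \<longleftrightarrow> (\<forall>P. pvars P \<subseteq> V \<longrightarrow> (peval a P = 0 \<longleftrightarrow> peval c P = 0))"

lemma same_relationsD: "same_relations V a c \<Longrightarrow> pvars P \<subseteq> V \<Longrightarrow> peval a P = 0 \<longleftrightarrow> peval c P = 0"
  unfolding same_relations_def by blast

text \<open>Having the same relations means that sending each \<open>a j\<close> to
  \<open>c j\<close> induces an isomorphism of the generated subrings, with graph \<open>G\<close>
  below. Adjoining \<open>a i\<close> is then the extension problem solved by
  \<open>extend\<close>.\<close>

lemma same_relations_extend1:
  fixes a :: "'v::countable \<Rightarrow> 'a::idom"
  assumes rel: "same_relations V a c" and i: "i \<notin> V"
  shows "\<exists>s. same_relations (insert i V) a (c(i := s))"
proof -
  define G where "G = (\<lambda>P. (peval a P, peval c P)) ` {P. pvars P \<subseteq> V}"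
  have mem: "(peval a P, peval c P) \<in> G" if "pvars P \<subseteq> V" for P using that by (auto simp: G_def)
  interpret partial_ring_iso G
  proof
    show "(of_int n, of_int n) \<in> G" for n using mem[of "PConst n"] by simp
    show "(x + x', y + y') \<in> G" if "(x, y) \<in> G" "(x', y') \<in> G" for x y x' y'
    proof -
      obtain P Q where "x = peval a P" "y = peval c P" "x' = peval a Q" "y' = peval c Q"
        "pvars P \<subseteq> V" "pvars Q \<subseteq> V" using \<open>(x, y) \<in> G\<close> \<open>(x', y') \<in> G\<close> by (auto simp: G_def)
      then show ?thesis using mem[of "PAdd P Q"] by simp
    qed
    show "(x * x', y * y') \<in> G" if "(x, y) \<in> G" "(x', y') \<in> G" for x y x' y'
    proof -
      obtain P Q where "x = peval a P" "y = peval c P" "x' = peval a Q" "y' = peval c Q"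
        "pvars P \<subseteq> V" "pvars Q \<subseteq> V" using \<open>(x, y) \<in> G\<close> \<open>(x', y') \<in> G\<close> by (auto simp: G_def)
      then show ?thesis using mem[of "PMul P Q"] by simp
    qed
    show "x = 0 \<longleftrightarrow> y = 0" if "(x, y) \<in> G" for x y
      using that same_relationsD[OF rel] by (auto simp: G_def)
    show "countable G" unfolding G_def by (intro countable_image) auto
  qed
  obtain s where s: "\<forall>(p, q)\<in>polys. poly p (a i) = 0 \<longleftrightarrow> poly q s = 0" using extend by blast
  \<comment> \<open>On both sides an expression over \<open>insert i V\<close> is a polynomial in
    the new element, with coefficients matched by \<open>G\<close>.\<close>
  have "\<exists>p q. (p, q) \<in> polys \<and> peval a P = poly p (a i) \<and> peval (c(i := s)) P = poly q s"
    if "pvars P \<subseteq> insert i V" for P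
    using that
  proof (induction P)
    case (PVar j)
    show ?case
    proof (cases "j = i")
      case True
      then show ?thesis using polys_monom[OF one_mem, of 1] by (force simp: poly_monom)
    next
      case False
      then have "(a j, c j) \<in> G" using mem[of "PVar j"] PVar by auto
      then show ?thesis using polys_monom[of "a j" "c j" 0] False by (force simp: poly_monom)
    qed
  next
    case (PConst n)
    then show ?case using polys_monom[OF of_int_mem, of n 0] by (force simp: poly_monom)
  next
    case (PAdd P Q)
    obtain p q where "(p, q) \<in> polys" "peval a P = poly p (a i)" "peval (c(i := s)) P = poly q s"
      using PAdd by (metis Un_subset_iff poly_expr.set(3))
    moreover obtain p' q' where "(p', q') \<in> polys" "peval a Q = poly p' (a i)" "peval (c(i := s)) Q = poly q' s"
      using PAdd by (metis Un_subset_iff poly_expr.set(3))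
    ultimately show ?case by (intro exI[of _ "p + p'"] exI[of _ "q + q'"]) (simp add: polys_add del: fun_upd_apply)
  next
    case (PMul P Q)
    obtain p q where "(p, q) \<in> polys" "peval a P = poly p (a i)" "peval (c(i := s)) P = poly q s"
      using PMul by (metis Un_subset_iff poly_expr.set(4))
    moreover obtain p' q' where "(p', q') \<in> polys" "peval a Q = poly p' (a i)" "peval (c(i := s)) Q = poly q' s"
      using PMul by (metis Un_subset_iff poly_expr.set(4))
    ultimately show ?case by (intro exI[of _ "p * p'"] exI[of _ "q * q'"]) (simp add: polys_mult del: fun_upd_apply)
  qed
  then have "peval a P = 0 \<longleftrightarrow> peval (c(i := s)) P = 0" if "pvars P \<subseteq> insert i V" for P
    using that s by fastforce
  then show ?thesis unfolding same_relations_def by blast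
qed

text \<open>Values outside \<open>W\<close> are kept, so the channel coefficients remain the given
  ones when beam coordinates are adjoined.\<close>

lemma same_relations_extend:
  fixes a :: "'v::countable \<Rightarrow> 'a::idom"
  assumes "finite W" "same_relations V a c" "W \<inter> V = {}"
  shows "\<exists>c'. same_relations (W \<union> V) a c' \<and> (\<forall>i. i \<notin> W \<longrightarrow> c' i = c i)"
  using assms(1,3)
proof (induction W rule: finite_induct)
  case empty
  then show ?case using assms(2) by auto
next
  case (insert i W)
  then obtain c' where c': "same_relations (W \<union> V) a c'" "\<forall>i. i \<notin> W \<longrightarrow> c' i = c i" by auto
  then obtain s where "same_relations (insert i (W \<union> V)) a (c'(i := s))"
    using same_relations_extend1[of "W \<union> V" a c' i] insert by auto
  then show ?case using c'(2) by (intro exI[of _ "c'(i := s)"]) (auto simp del: fun_upd_apply simp: fun_upd_other)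
qed

section \<open>Counting monomials\<close>

text \<open>Gaussian elimination without division, with pivot \<open>M a0 b\<close>, keeps the
  dependence integral, as required by a notion of independence that speaks of integer
  relations.\<close>

lemma int_linear_dependence:
  fixes M :: "'a \<Rightarrow> 'b \<Rightarrow> int"
  assumes "finite A" "finite B" "card B < card A"
  shows "\<exists>c. (\<exists>a\<in>A. c a \<noteq> 0) \<and> (\<forall>b\<in>B. (\<Sum>a\<in>A. c a * M a b) = 0)"
  using assms(2,1,3)
proof (induction B arbitrary: A M rule: finite_induct)
  case empty
  then have "A \<noteq> {}" by auto
  then show ?case by (intro exI[of _ "\<lambda>_. 1"]) auto
next
  case (insert b B)
  show ?case
  proof (cases "\<forall>a\<in>A. M a b = 0")
    case True
    then show ?thesis using insert.IH[of A M] insert.prems insert.hyps by auto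
  next
    case False
    then obtain a0 where a0: "a0 \<in> A" "M a0 b \<noteq> 0" by blast
    define A' where "A' = A - {a0}"
    have A': "finite A'" "a0 \<notin> A'" "A = insert a0 A'" "card B < card A'"
      using insert.prems insert.hyps a0 by (auto simp: A'_def)
    obtain c where c: "\<exists>a\<in>A'. c a \<noteq> 0"
      "\<forall>b'\<in>B. (\<Sum>a\<in>A'. c a * (M a0 b * M a b' - M a b * M a0 b')) = 0"
      using insert.IH[of A' "\<lambda>a b'. M a0 b * M a b' - M a b * M a0 b'"] A' by blast
    define c' where "c' = (\<lambda>a. if a = a0 then - (\<Sum>a\<in>A'. c a * M a b) else M a0 b * c a)"
    have c'_sum: "(\<Sum>a\<in>A. c' a * M a b') = (\<Sum>a\<in>A'. M a0 b * c a * M a b') - (\<Sum>a\<in>A'. c a * M a b) * M a0 b'" for b'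
    proof -
      have "(\<Sum>a\<in>A'. c' a * M a b') = (\<Sum>a\<in>A'. M a0 b * c a * M a b')"
        using A'(2) by (intro sum.cong) (auto simp: c'_def)
      then show ?thesis using A' by (simp add: c'_def)
    qed
    have "(\<Sum>a\<in>A. c' a * M a b') = 0" if "b' \<in> insert b B" for b'
    proof (cases "b' = b")
      case True
      then show ?thesis unfolding c'_sum by (simp add: sum_distrib_left sum_distrib_right algebra_simps)
    next
      case False
      then have "(\<Sum>a\<in>A'. c a * (M a0 b * M a b' - M a b * M a0 b')) = 0" using c(2) that by blast
      then show ?thesis unfolding c'_sum
        by (simp add: sum_distrib_left sum_distrib_right sum_subtractf algebra_simps)
    qed
    moreover have "\<exists>a\<in>A. c' a \<noteq> 0" using c(1) a0 A' by (auto simp: c'_def)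
    ultimately show ?thesis by blast
  qed
qed

section \<open>Integer combinations of monomials with bounded exponents\<close>

inductive_set zspan :: "complex set \<Rightarrow> complex set" for M where
  zero: "0 \<in> zspan M"
| step: "m \<in> M \<Longrightarrow> z \<in> zspan M \<Longrightarrow> of_int n * m + z \<in> zspan M"

lemma zspan_base: "m \<in> M \<Longrightarrow> m \<in> zspan M"
  using zspan.step[of m M 0 1] zspan.zero by simp

lemma zspan_add: "z \<in> zspan M \<Longrightarrow> w \<in> zspan M \<Longrightarrow> z + w \<in> zspan M"
  by (induction rule: zspan.induct) (auto simp: add.assoc intro: zspan.step)

lemma zspan_of_int_mult: "z \<in> zspan M \<Longrightarrow> of_int n * z \<in> zspan M"
proof (induction rule: zspan.induct)
  case (step m z k)
  then show ?case using zspan.step[of m M "of_int n * z" "n * k"] by (simp add: algebra_simps)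
qed (simp add: zspan.zero)

lemma zspan_mono: "M \<subseteq> N \<Longrightarrow> zspan M \<subseteq> zspan N"
proof
  fix z assume "M \<subseteq> N" "z \<in> zspan M"
  from this(2,1) show "z \<in> zspan N" by (induction rule: zspan.induct) (auto intro: zspan.intros)
qed

lemma zspan_mult:
  assumes MN: "\<And>m n. m \<in> M \<Longrightarrow> n \<in> N \<Longrightarrow> m * n \<in> L" and "z \<in> zspan M" "w \<in> zspan N"
  shows "z * w \<in> zspan L"
  using assms(2)
proof (induction rule: zspan.induct)
  case (step m z k)
  have "m * w \<in> zspan L" using assms(3)
  proof (induction rule: zspan.induct)
    case (step n w i)
    then show ?case using zspan.step[of "m * n" L "m * w" i] MN \<open>m \<in> M\<close> by (simp add: algebra_simps)
  qed (simp add: zspan.zero)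
  then show ?case using zspan_add[OF zspan_of_int_mult[of "m * w" L k] step.IH]
    by (simp add: algebra_simps)
qed (simp add: zspan.zero)

lemma zspan_image:
  assumes "finite A" "z \<in> zspan (f ` A)"
  shows "\<exists>c. z = (\<Sum>a\<in>A. of_int (c a) * f a)"
  using assms(2)
proof (induction rule: zspan.induct)
  case zero
  then show ?case by (intro exI[of _ "\<lambda>_. 0"]) simp
next
  case (step m z n)
  then obtain c a where c: "z = (\<Sum>a\<in>A. of_int (c a) * f a)" and a: "a \<in> A" "m = f a" by blast
  have "of_int n * m + z = (\<Sum>b\<in>A. (if b = a then of_int n * f b else 0) + of_int (c b) * f b)"
    using a assms(1) by (simp add: c sum.distrib sum.delta)
  also have "\<dots> = (\<Sum>b\<in>A. of_int ((if b = a then n else 0) + c b) * f b)"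
    by (intro sum.cong) (auto simp: algebra_simps)
  finally show ?case by (intro exI[of _ "\<lambda>b. (if b = a then n else 0) + c b"])
qed

text \<open>The bound applies to each exponent separately rather than to the total degree, so that
  for finite \<open>J\<close> there are exactly \<open>(d + 1) ^ card J\<close> exponent
  functions.\<close>

definition monomials :: "'v set \<Rightarrow> ('v \<Rightarrow> complex) \<Rightarrow> nat \<Rightarrow> complex set" where
  "monomials J x d = (\<lambda>\<alpha>. \<Prod>i\<in>J. x i ^ \<alpha> i) ` (J \<rightarrow>\<^sub>E {..d})"

lemma monomialsI:
  assumes "\<And>i. i \<in> J \<Longrightarrow> \<alpha> i \<le> d" shows "(\<Prod>i\<in>J. x i ^ \<alpha> i) \<in> monomials J x d"
  unfolding monomials_def by (intro image_eqI[of _ _ "restrict \<alpha> J"]) (use assms in auto)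

lemma monomials_mult:
  "m \<in> monomials J x d \<Longrightarrow> n \<in> monomials J x e \<Longrightarrow> m * n \<in> monomials J x (d + e)"
proof -
  assume "m \<in> monomials J x d" "n \<in> monomials J x e"
  then obtain \<alpha> \<beta> where "m = (\<Prod>i\<in>J. x i ^ \<alpha> i)" "n = (\<Prod>i\<in>J. x i ^ \<beta> i)"
    "\<alpha> \<in> J \<rightarrow>\<^sub>E {..d}" "\<beta> \<in> J \<rightarrow>\<^sub>E {..e}" unfolding monomials_def by blast
  then show ?thesis using monomialsI[of J "\<lambda>i. \<alpha> i + \<beta> i" "d + e" x]
    by (force simp: power_add prod.distrib PiE_iff intro: add_mono)
qed

lemma monomials_mono: "d \<le> e \<Longrightarrow> monomials J x d \<subseteq> monomials J x e"
  unfolding monomials_def by (intro image_mono PiE_mono) auto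

abbreviation deg_le :: "'v set \<Rightarrow> ('v \<Rightarrow> complex) \<Rightarrow> nat \<Rightarrow> complex set" where
  "deg_le J x d \<equiv> zspan (monomials J x d)"

lemma deg_le_mono: "d \<le> e \<Longrightarrow> z \<in> deg_le J x d \<Longrightarrow> z \<in> deg_le J x e"
  using zspan_mono[OF monomials_mono] by blast

lemma deg_le_mult: "z \<in> deg_le J x d \<Longrightarrow> w \<in> deg_le J x e \<Longrightarrow> z * w \<in> deg_le J x (d + e)"
  by (rule zspan_mult[OF monomials_mult])

lemma deg_le_one: "1 \<in> deg_le J x d"
  using zspan_base[OF monomialsI[of J "\<lambda>_. 0" d x]] by simp

lemma deg_le_power: "z \<in> deg_le J x d \<Longrightarrow> z ^ n \<in> deg_le J x (n * d)"
  by (induction n) (auto intro: deg_le_one deg_le_mult)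

lemma deg_le_prod:
  "finite A \<Longrightarrow> (\<And>i. i \<in> A \<Longrightarrow> f i \<in> deg_le J x (g i)) \<Longrightarrow> prod f A \<in> deg_le J x (sum g A)"
  by (induction A rule: finite_induct) (auto intro: deg_le_one deg_le_mult)

lemma peval_deg_le:
  assumes "finite J" "pvars P \<subseteq> J" shows "\<exists>d. peval x P \<in> deg_le J x d"
  using assms(2)
proof (induction P)
  case (PVar i)
  have "(\<Prod>j\<in>J. x j ^ (if j = i then 1 else 0)) \<in> monomials J x 1" by (rule monomialsI) simp
  moreover have "(\<Prod>j\<in>J. x j ^ (if j = i then 1 else 0)) = (\<Prod>j\<in>J. if j = i then x j else 1)"
    by (intro prod.cong) auto
  ultimately have "x i \<in> monomials J x 1" using PVar assms(1) by (simp add: prod.delta)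
  then show ?case using zspan_base by (metis peval.simps(1))
next
  case (PConst n)
  then show ?case using zspan_of_int_mult[OF deg_le_one, of n J x 0] by auto
next
  case (PAdd P Q)
  then obtain d e where "peval x P \<in> deg_le J x d" "peval x Q \<in> deg_le J x e" by auto
  then have "peval x P \<in> deg_le J x (d + e)" "peval x Q \<in> deg_le J x (d + e)"
    by (auto elim: deg_le_mono[rotated])
  then have "peval x (PAdd P Q) \<in> deg_le J x (d + e)" by (simp add: zspan_add)
  then show ?case by blast
next
  case (PMul P Q)
  then show ?case using deg_le_mult by fastforce
qed

text \<open>As a polynomial in the single variable \<open>z i\<close>, the sum vanishes identically
  only if each coefficient does, and the coefficients are sums of the same form in fewer
  variables.\<close>

lemma monomial_functions_independent:
  fixes c :: "('v \<Rightarrow> nat) \<Rightarrow> complex"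
  assumes "finite I" "\<And>z :: 'v \<Rightarrow> complex. (\<Sum>\<alpha>\<in>I \<rightarrow>\<^sub>E {..d}. c \<alpha> * (\<Prod>i\<in>I. z i ^ \<alpha> i)) = 0"
    and "\<alpha> \<in> I \<rightarrow>\<^sub>E {..d}"
  shows "c \<alpha> = 0"
  using assms
proof (induction I arbitrary: c \<alpha> rule: finite_induct)
  case empty
  then show ?case by simp
next
  case (insert i I)
  have split: "(\<Sum>\<alpha>\<in>insert i I \<rightarrow>\<^sub>E {..d}. g \<alpha>) = (\<Sum>e\<le>d. \<Sum>\<beta>\<in>I \<rightarrow>\<^sub>E {..d}. g (\<beta>(i := e)))"
    for g :: "_ \<Rightarrow> complex"
  proof -
    have "inj_on (\<lambda>(y, g). g(i := y)) ({..d} \<times> (I \<rightarrow>\<^sub>E {..d}))"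
      using insert.hyps inj_combinator[of i I "\<lambda>_. {..d}"] by simp
    then show ?thesis unfolding PiE_insert_eq
      by (subst sum.reindex) (auto simp: sum.cartesian_product case_prod_beta)
  qed
  have "(\<Sum>\<beta>\<in>I \<rightarrow>\<^sub>E {..d}. c (\<beta>(i := e)) * (\<Prod>j\<in>I. z j ^ \<beta> j)) = 0" if "e \<le> d" for e and z :: "'v \<Rightarrow> complex"
  proof -
    have "(\<Sum>e\<le>d. (\<Sum>\<beta>\<in>I \<rightarrow>\<^sub>E {..d}. c (\<beta>(i := e)) * (\<Prod>j\<in>I. z j ^ \<beta> j)) * t ^ e) = 0" for t
    proof -
      have "(\<Prod>j\<in>insert i I. (z(i := t)) j ^ (\<beta>(i := e)) j) = (\<Prod>j\<in>I. z j ^ \<beta> j) * t ^ e" for \<beta> e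
      proof -
        have "(\<Prod>j\<in>I. (z(i := t)) j ^ (\<beta>(i := e)) j) = (\<Prod>j\<in>I. z j ^ \<beta> j)"
          using insert.hyps by (intro prod.cong) auto
        then show ?thesis using insert.hyps by simp
      qed
      then show ?thesis using insert.prems(1)[of "z(i := t)"] unfolding split
        by (simp add: sum_distrib_right mult.assoc del: fun_upd_apply)
    qed
    then show ?thesis
      using polyfun_eq_0[of "\<lambda>e. \<Sum>\<beta>\<in>I \<rightarrow>\<^sub>E {..d}. c (\<beta>(i := e)) * (\<Prod>j\<in>I. z j ^ \<beta> j)" d] that by blast
  qed
  then have "c (\<beta>(i := e)) = 0" if "e \<le> d" "\<beta> \<in> I \<rightarrow>\<^sub>E {..d}" for e \<beta>
    using insert.IH[of "\<lambda>\<beta>. c (\<beta>(i := e))"] that by blast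
  moreover obtain e \<beta> where "\<alpha> = \<beta>(i := e)" "e \<le> d" "\<beta> \<in> I \<rightarrow>\<^sub>E {..d}"
    using insert.prems(2) unfolding PiE_insert_eq by auto
  ultimately show ?case by blast
qed

section \<open>Integer polynomial functions and the rings they generate\<close>

definition poly_fun :: "'v set \<Rightarrow> (('v \<Rightarrow> complex) \<Rightarrow> complex) \<Rightarrow> bool" where
  "poly_fun V f \<longleftrightarrow> (\<exists>P. pvars P \<subseteq> V \<and> (\<forall>z. peval z P = f z))"

lemma poly_fun_var: "i \<in> V \<Longrightarrow> poly_fun V (\<lambda>z. z i)"
  unfolding poly_fun_def by (intro exI[of _ "PVar i"]) simp

lemma poly_fun_of_int: "poly_fun V (\<lambda>z. of_int n)"
  unfolding poly_fun_def by (intro exI[of _ "PConst n"]) simp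

lemma poly_fun_add: "poly_fun V f \<Longrightarrow> poly_fun V g \<Longrightarrow> poly_fun V (\<lambda>z. f z + g z)"
  unfolding poly_fun_def by (metis Un_least peval.simps(3) poly_expr.set(3))

lemma poly_fun_mult: "poly_fun V f \<Longrightarrow> poly_fun V g \<Longrightarrow> poly_fun V (\<lambda>z. f z * g z)"
  unfolding poly_fun_def by (metis Un_least peval.simps(4) poly_expr.set(4))

lemma poly_fun_sum:
  "finite A \<Longrightarrow> (\<And>i. i \<in> A \<Longrightarrow> poly_fun V (f i)) \<Longrightarrow> poly_fun V (\<lambda>z. \<Sum>i\<in>A. f i z)"
  by (induction A rule: finite_induct) (auto intro: poly_fun_add poly_fun_of_int[of _ 0, simplified])

lemma poly_fun_prod:
  "finite A \<Longrightarrow> (\<And>i. i \<in> A \<Longrightarrow> poly_fun V (f i)) \<Longrightarrow> poly_fun V (\<lambda>z. \<Prod>i\<in>A. f i z)"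
  by (induction A rule: finite_induct) (auto intro: poly_fun_mult poly_fun_of_int[of _ 1, simplified])

lemma poly_fun_power: "poly_fun V f \<Longrightarrow> poly_fun V (\<lambda>z. f z ^ n)"
  by (induction n) (auto intro: poly_fun_mult poly_fun_of_int[of _ 1, simplified])

lemma alg_indep_poly_fun:
  "alg_indep V x \<Longrightarrow> poly_fun V f \<Longrightarrow> f x = 0 \<Longrightarrow> f z = 0"
  unfolding poly_fun_def by (metis alg_indepD)

text \<open>This is the subring Z[x_j : j in J] of the complex numbers.\<close>

definition ring_gen :: "'v set \<Rightarrow> ('v \<Rightarrow> complex) \<Rightarrow> complex set" where
  "ring_gen J x = {f x |f. poly_fun J f}"

lemma ring_gen_var: "i \<in> J \<Longrightarrow> x i \<in> ring_gen J x"
  unfolding ring_gen_def by (auto intro: poly_fun_var exI[of _ "\<lambda>z. z i"])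

lemma ring_gen_of_int: "of_int n \<in> ring_gen J x"
  unfolding ring_gen_def by (auto intro: poly_fun_of_int exI[of _ "\<lambda>z. of_int n"])

lemma ring_gen_add: "a \<in> ring_gen J x \<Longrightarrow> b \<in> ring_gen J x \<Longrightarrow> a + b \<in> ring_gen J x"
  unfolding ring_gen_def using poly_fun_add by fastforce

lemma ring_gen_mult: "a \<in> ring_gen J x \<Longrightarrow> b \<in> ring_gen J x \<Longrightarrow> a * b \<in> ring_gen J x"
  unfolding ring_gen_def using poly_fun_mult by fastforce

lemma ring_gen_uminus: "a \<in> ring_gen J x \<Longrightarrow> - a \<in> ring_gen J x"
  using ring_gen_mult[OF ring_gen_of_int[of "-1"]] by fastforce

lemma ring_gen_sum: "finite A \<Longrightarrow> (\<And>i. i \<in> A \<Longrightarrow> f i \<in> ring_gen J x) \<Longrightarrow> sum f A \<in> ring_gen J x"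
  by (induction A rule: finite_induct) (auto intro: ring_gen_add ring_gen_of_int[of 0, simplified])

lemma ring_gen_prod: "finite A \<Longrightarrow> (\<And>i. i \<in> A \<Longrightarrow> f i \<in> ring_gen J x) \<Longrightarrow> prod f A \<in> ring_gen J x"
  by (induction A rule: finite_induct) (auto intro: ring_gen_mult ring_gen_of_int[of 1, simplified])

lemma ring_gen_deg_le:
  assumes "finite J" "a \<in> ring_gen J x" shows "\<exists>d. a \<in> deg_le J x d"
  using assms peval_deg_le[OF assms(1)] unfolding ring_gen_def poly_fun_def by force

text \<open>The common denominator \<open>D\<close> is cleared by multiplying a monomial of total degree \<open>s\<close> with
  \<open>D ^ (N * d)\<close>, where \<open>s \<le> N * d\<close>. The \<open>(d + 1) ^ card I\<close> resulting elements are integer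
  combinations of only \<open>(N * d * b + 1) ^ card J\<close> monomials, so for large \<open>d\<close> they are dependent.\<close>

lemma alg_indep_card_le:
  fixes x :: "'v \<Rightarrow> complex" and y :: "'w \<Rightarrow> complex"
  assumes J: "finite J" and I: "finite I" and D: "D \<in> ring_gen J x" "D \<noteq> 0"
    and y: "\<And>i. i \<in> I \<Longrightarrow> D * y i \<in> ring_gen J x"
    and indep: "alg_indep I y"
  shows "card I \<le> card J"
proof (rule ccontr)
  assume "\<not> card I \<le> card J"
  then have less: "card J < card I" by simp
  define N where "N = card I"
  obtain e where e: "D \<in> deg_le J x e" using ring_gen_deg_le[OF J D(1)] by blast
  obtain f where f: "\<And>i. i \<in> I \<Longrightarrow> D * y i \<in> deg_le J x (f i)" using ring_gen_deg_le[OF J y] by metis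
  define b where "b = e + sum f I"
  have Db: "D \<in> deg_le J x b" using e deg_le_mono[of e b] by (simp add: b_def)
  have yb: "D * y i \<in> deg_le J x b" if "i \<in> I" for i
    using f[OF that] deg_le_mono[of "f i" b] member_le_sum[of i I f] that I by (simp add: b_def)
  \<comment> \<open>The choice of \<open>d\<close> absorbs a constant factor: \<open>card B\<close>
    is at most \<open>(b * N + 1) ^ card J * (d + 1) ^ card J = d * (d + 1) ^ card J\<close>, which
    is below \<open>(d + 1) ^ card I\<close>.\<close>
  define d where "d = (b * N + 1) ^ card J"
  define A where "A = I \<rightarrow>\<^sub>E {..d}"
  define B where "B = J \<rightarrow>\<^sub>E {..N * d * b}"
  have finA: "finite A" and finB: "finite B" using I J by (auto simp: A_def B_def intro: finite_PiE)
  have "card B = (N * d * b + 1) ^ card J" using J by (simp add: B_def card_PiE)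
  also have "\<dots> \<le> ((b * N + 1) * (d + 1)) ^ card J" by (intro power_mono) (auto simp: algebra_simps)
  also have "\<dots> = d * (d + 1) ^ card J" by (simp only: power_mult_distrib d_def[symmetric])
  also have "\<dots> < (d + 1) ^ Suc (card J)" by simp
  also have "\<dots> \<le> (d + 1) ^ card I" using less by (intro power_increasing) auto
  also have "\<dots> = card A" using I by (simp add: A_def card_PiE)
  finally have card: "card B < card A" .
  define expands where "expands \<alpha> m \<longleftrightarrow>
    D ^ (N * d) * (\<Prod>i\<in>I. y i ^ \<alpha> i) = (\<Sum>\<beta>\<in>B. of_int (m \<beta>) * (\<Prod>j\<in>J. x j ^ \<beta> j))" for \<alpha> m
  have "\<exists>m. expands \<alpha> m" if "\<alpha> \<in> A" for \<alpha>
  proof -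
    define s where "s = sum \<alpha> I"
    have "s \<le> (\<Sum>i\<in>I. d)" unfolding s_def by (rule sum_mono) (use that in \<open>auto simp: A_def\<close>)
    then have s: "s \<le> N * d" by (simp add: N_def)
    have "D ^ (N * d) * (\<Prod>i\<in>I. y i ^ \<alpha> i) = D ^ (N * d - s) * (\<Prod>i\<in>I. (D * y i) ^ \<alpha> i)"
      using s by (simp add: power_mult_distrib prod.distrib s_def power_sum[symmetric] mult.assoc[symmetric]
          power_add[symmetric])
    also have "\<dots> \<in> deg_le J x ((N * d - s) * b + (\<Sum>i\<in>I. \<alpha> i * b))"
      by (intro deg_le_mult deg_le_power Db deg_le_prod I yb)
    also have "(N * d - s) * b + (\<Sum>i\<in>I. \<alpha> i * b) = N * d * b"
      using s by (simp add: sum_distrib_right[symmetric] s_def[symmetric] add_mult_distrib[symmetric])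
    finally show ?thesis using zspan_image[OF finB] unfolding expands_def monomials_def B_def by blast
  qed
  then obtain M where "\<And>\<alpha>. \<alpha> \<in> A \<Longrightarrow> expands \<alpha> (M \<alpha>)" by metis
  note M = this[unfolded expands_def]
  obtain c where c: "\<exists>\<alpha>\<in>A. c \<alpha> \<noteq> 0" "\<forall>\<beta>\<in>B. (\<Sum>\<alpha>\<in>A. c \<alpha> * M \<alpha> \<beta>) = 0"
    using int_linear_dependence[OF finA finB card] by blast
  define g where "g = (\<lambda>z :: 'w \<Rightarrow> complex. \<Sum>\<alpha>\<in>A. of_int (c \<alpha>) * (\<Prod>i\<in>I. z i ^ \<alpha> i))"
  have "D ^ (N * d) * g y = (\<Sum>\<alpha>\<in>A. of_int (c \<alpha>) * (D ^ (N * d) * (\<Prod>i\<in>I. y i ^ \<alpha> i)))"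
    by (simp add: g_def sum_distrib_left algebra_simps)
  also have "\<dots> = (\<Sum>\<alpha>\<in>A. \<Sum>\<beta>\<in>B. of_int (c \<alpha> * M \<alpha> \<beta>) * (\<Prod>j\<in>J. x j ^ \<beta> j))"
    by (intro sum.cong refl) (simp add: M sum_distrib_left algebra_simps)
  also have "\<dots> = (\<Sum>\<beta>\<in>B. of_int (\<Sum>\<alpha>\<in>A. c \<alpha> * M \<alpha> \<beta>) * (\<Prod>j\<in>J. x j ^ \<beta> j))"
    by (subst sum.swap) (simp add: sum_distrib_right)
  also have "\<dots> = 0" using c(2) by (intro sum.neutral) simp
  finally have "g y = 0" using D(2) by simp
  moreover have "poly_fun I g" unfolding g_def
    by (intro poly_fun_sum finA poly_fun_mult poly_fun_of_int poly_fun_prod I poly_fun_power poly_fun_var)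
  ultimately have "g z = 0" for z using alg_indep_poly_fun[OF indep] by blast
  then have "of_int (c \<alpha>) = (0 :: complex)" if "\<alpha> \<in> A" for \<alpha>
    using monomial_functions_independent[OF I, of "\<lambda>\<alpha>. of_int (c \<alpha>)" d] that unfolding g_def A_def by blast
  then show False using c(1) by auto
qed

section \<open>Algebraic independence of independent continuous random variables\<close>

lemma poly_fun_cong:
  assumes "poly_fun V f" "\<And>i. i \<in> V \<Longrightarrow> y i = z i" shows "f y = f z"
proof -
  obtain P where P: "pvars P \<subseteq> V" "\<And>z. peval z P = f z" using assms(1) unfolding poly_fun_def by blast
  have "peval y P = peval z P" by (rule peval_cong) (use P assms(2) in auto)
  then show ?thesis by (simp add: P(2))
qed

lemma poly_fun_measurable:
  assumes "poly_fun V f" "\<And>i. i \<in> V \<Longrightarrow> sets (\<mu> i) = sets borel"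
  shows "f \<in> borel_measurable (PiM V \<mu>)"
proof -
  have "(\<lambda>x. peval x P) \<in> borel_measurable (PiM V \<mu>)" if "pvars P \<subseteq> V" for P :: "_ poly_expr"
    using that
  proof (induction P)
    case (PVar i)
    then have "(\<lambda>x. x i) \<in> measurable (PiM V \<mu>) (\<mu> i)" by (intro measurable_component_singleton) auto
    then show ?case using assms(2)[of i] PVar by (simp cong: measurable_cong_sets)
  qed (auto intro: borel_measurable_add borel_measurable_times)
  then show ?thesis using assms(1) unfolding poly_fun_def by (metis (no_types, lifting) ext)
qed

text \<open>Isolating one coordinate as the variable of a univariate polynomial prepares the
  integration over that coordinate.\<close>

lemma poly_fun_insert_cases:
  assumes "poly_fun (insert i V) f"
  shows "\<exists>p. (\<forall>n. poly_fun V (\<lambda>z. coeff (p z) n)) \<and> (\<forall>z. f z = poly (p z) (z i))"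
proof -
  have "\<exists>p. (\<forall>n. poly_fun V (\<lambda>z. coeff (p z) n)) \<and> (\<forall>z. peval z P = poly (p z) (z i))"
    if "pvars P \<subseteq> insert i V" for P
    using that
  proof (induction P)
    case (PVar j)
    show ?case
    proof (cases "j = i")
      case True
      have "poly_fun V (\<lambda>z. coeff (monom 1 1) n)" for n
        using poly_fun_of_int[of V "if n = 1 then 1 else 0"] by (auto simp: coeff_monom split: if_splits)
      then show ?thesis using True by (intro exI[of _ "\<lambda>_. monom 1 1"]) (simp add: poly_monom)
    next
      case False
      then have "poly_fun V (\<lambda>z. coeff [:z j:] n)" for n
        using PVar poly_fun_var[of j V] poly_fun_of_int[of V 0] by (cases n) auto
      then show ?thesis by (intro exI[of _ "\<lambda>z. [:z j:]"]) simp
    qed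
  next
    case (PConst m)
    have "poly_fun V (\<lambda>z. coeff [:of_int m:] n)" for n
      using poly_fun_of_int[of V m] poly_fun_of_int[of V 0] by (cases n) auto
    then show ?case by (intro exI[of _ "\<lambda>z. [:of_int m:]"]) simp
  next
    case (PAdd P Q)
    obtain p where "\<forall>n. poly_fun V (\<lambda>z. coeff (p z) n)" "\<forall>z. peval z P = poly (p z) (z i)"
      using PAdd by auto
    moreover obtain q where "\<forall>n. poly_fun V (\<lambda>z. coeff (q z) n)" "\<forall>z. peval z Q = poly (q z) (z i)"
      using PAdd by auto
    ultimately show ?case by (intro exI[of _ "\<lambda>z. p z + q z"]) (simp add: poly_fun_add)
  next
    case (PMul P Q)
    obtain p where "\<forall>n. poly_fun V (\<lambda>z. coeff (p z) n)" "\<forall>z. peval z P = poly (p z) (z i)"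
      using PMul by auto
    moreover obtain q where "\<forall>n. poly_fun V (\<lambda>z. coeff (q z) n)" "\<forall>z. peval z Q = poly (q z) (z i)"
      using PMul by auto
    ultimately show ?case
      by (intro exI[of _ "\<lambda>z. p z * q z"]) (simp add: coeff_mult poly_fun_sum poly_fun_mult)
  qed
  then show ?thesis using assms unfolding poly_fun_def by metis
qed

text \<open>By induction some coefficient with respect to coordinate \<open>i\<close> is nonzero
  almost surely. Where it is nonzero, only finitely many values of that coordinate are roots, and
  they have measure zero; Fubini's theorem combines the slices.\<close>

lemma AE_PiM_poly_fun_nonzero:
  fixes \<mu> :: "'i \<Rightarrow> complex measure"
  assumes prob: "\<And>i. prob_space (\<mu> i)" and sets: "\<And>i. sets (\<mu> i) = sets borel"
    and atomless: "\<And>i c. i \<in> V \<Longrightarrow> AE x in \<mu> i. x \<noteq> c"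
    and "finite V" "poly_fun V f" "f z \<noteq> 0"
  shows "AE x in PiM V \<mu>. f x \<noteq> 0"
  using assms(4,3,5,6)
proof (induction V arbitrary: f z rule: finite_induct)
  case empty
  have "f x = f z" for x by (rule poly_fun_cong[OF empty(2)]) simp
  then have "f x \<noteq> 0" for x using empty(3) by metis
  then show ?case by simp
next
  case (insert i V)
  interpret product_sigma_finite \<mu>
    unfolding product_sigma_finite_def using prob prob_space_imp_sigma_finite by blast
  obtain p where p: "\<And>n. poly_fun V (\<lambda>z. coeff (p z) n)" "\<And>z. f z = poly (p z) (z i)"
    using poly_fun_insert_cases[OF insert.prems(2)] by blast
  have "p z \<noteq> 0" using insert.prems(3) p(2) by auto
  then obtain n where n: "coeff (p z) n \<noteq> 0" by (auto simp: poly_eq_iff)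
  have AE_V: "AE x in PiM V \<mu>. coeff (p x) n \<noteq> 0"
    using insert.IH[OF _ p(1) n] insert.prems(1) by blast
  define B where "B = {x \<in> space (PiM (insert i V) \<mu>). f x = 0}"
  have f_meas: "f \<in> borel_measurable (PiM (insert i V) \<mu>)"
    by (rule poly_fun_measurable[OF insert.prems(2) sets])
  then have B: "B \<in> sets (PiM (insert i V) \<mu>)"
    unfolding B_def by measurable
  have slice: "(\<integral>\<^sup>+ y. indicator B (x(i := y)) \<partial>\<mu> i) = 0" if x: "coeff (p x) n \<noteq> 0" for x
  proof -
    have "p x \<noteq> 0" using x by auto
    then have "AE y in \<mu> i. \<forall>c\<in>{c. poly (p x) c = 0}. y \<noteq> c"
      by (intro AE_ball_countable' insert.prems(1) countable_finite poly_roots_finite) auto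
    moreover have "p (x(i := y)) = p x" for y
    proof (rule poly_eqI)
      show "coeff (p (x(i := y))) m = coeff (p x) m" for m
        by (rule poly_fun_cong[OF p(1)]) (use insert.hyps in auto)
    qed
    ultimately have "AE y in \<mu> i. indicator B (x(i := y)) = (0 :: ennreal)"
      by (auto simp: B_def p(2) indicator_def elim!: eventually_mono)
    then show ?thesis by (subst nn_integral_cong_AE) auto
  qed
  have "emeasure (PiM (insert i V) \<mu>) B = (\<integral>\<^sup>+ x. indicator B x \<partial>PiM (insert i V) \<mu>)"
    using B by simp
  also have "\<dots> = (\<integral>\<^sup>+ x. (\<integral>\<^sup>+ y. indicator B (x(i := y)) \<partial>\<mu> i) \<partial>PiM V \<mu>)"
    using B insert.hyps by (intro product_nn_integral_insert) auto
  also have "\<dots> = (\<integral>\<^sup>+ x. 0 \<partial>PiM V \<mu>)"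
    by (rule nn_integral_cong_AE) (use AE_V slice in \<open>auto elim!: eventually_mono\<close>)
  finally have "emeasure (PiM (insert i V) \<mu>) B = 0" by simp
  then show ?case
    by (intro AE_I[of _ _ B]) (use B in \<open>auto simp: B_def\<close>)
qed

lemma (in prob_space) AE_poly_fun_nonzero:
  fixes X :: "'i \<Rightarrow> 'a \<Rightarrow> complex"
  assumes indep: "indep_vars (\<lambda>_. borel) X V" and V: "finite V"
    and atomless: "\<And>i c. i \<in> V \<Longrightarrow> AE x in distr M borel (X i). x \<noteq> c"
    and f: "poly_fun V f" "f z \<noteq> 0"
  shows "AE \<omega> in M. f (\<lambda>i. X i \<omega>) \<noteq> 0"
proof (cases "V = {}")
  case True
  have "f (\<lambda>i. X i \<omega>) = f z" for \<omega> by (rule poly_fun_cong[OF f(1)]) (simp add: True)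
  then show ?thesis using f by simp
next
  case False
  \<comment> \<open>The product measure results ask for a probability measure at every index, so
    indices outside \<open>V\<close> receive a point mass.\<close>
  define \<mu> where "\<mu> i = (if i \<in> V then distr M borel (X i) else return borel 0)" for i
  have rv: "X i \<in> borel_measurable M" if "i \<in> V" for i
    using indep that unfolding indep_vars_def by auto
  have prob: "prob_space (\<mu> i)" for i
    unfolding \<mu>_def using rv by (auto intro: prob_space_distr prob_space_return)
  have sets: "sets (\<mu> i) = sets borel" for i by (simp add: \<mu>_def)
  have meas: "(\<lambda>x. \<lambda>i\<in>V. X i x) \<in> measurable M (PiM V (\<lambda>_. borel))"
    using rv by (intro measurable_restrict) auto
  have AE_PiM: "AE x in PiM V \<mu>. f x \<noteq> 0"
  proof (rule AE_PiM_poly_fun_nonzero[OF prob sets _ V f])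
    fix i c assume "i \<in> V"
    then have "\<mu> i = distr M borel (X i)" by (simp add: \<mu>_def)
    then show "AE x in \<mu> i. x \<noteq> c" using atomless[OF \<open>i \<in> V\<close>, of c] by (simp only:)
  qed
  have PiM_eq: "PiM V \<mu> = distr M (PiM V (\<lambda>_. borel)) (\<lambda>x. \<lambda>i\<in>V. X i x)"
  proof -
    have "PiM V \<mu> = PiM V (\<lambda>i. distr M borel (X i))" by (intro PiM_cong) (auto simp: \<mu>_def)
    then show ?thesis using indep_vars_iff_distr_eq_PiM'[OF False rv] indep by simp
  qed
  have "AE x in distr M (PiM V (\<lambda>_. borel)) (\<lambda>x. \<lambda>i\<in>V. X i x). f x \<noteq> 0"
    using AE_PiM unfolding PiM_eq .
  moreover have "f \<in> borel_measurable (PiM V (\<lambda>_. borel))" by (rule poly_fun_measurable[OF f(1)]) simp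
  then have "{x \<in> space (PiM V (\<lambda>_. borel)). f x \<noteq> 0} \<in> sets (PiM V (\<lambda>_. borel))"
    by measurable
  ultimately have "AE \<omega> in M. f (\<lambda>i\<in>V. X i \<omega>) \<noteq> 0" using AE_distr_iff[OF meas, where P = "\<lambda>x. f x \<noteq> 0"] by blast
  moreover have "f (\<lambda>i\<in>V. X i \<omega>) = f (\<lambda>i. X i \<omega>)" for \<omega> by (rule poly_fun_cong[OF f(1)]) simp
  ultimately show ?thesis by simp
qed

text \<open>Each relation involves finitely many variables, so the finite case excludes it although
  \<open>V\<close> may be infinite. Countably many null sets are then united.\<close>

lemma (in prob_space) AE_alg_indep:
  fixes X :: "'i::countable \<Rightarrow> 'a \<Rightarrow> complex"
  assumes indep: "indep_vars (\<lambda>_. borel) X V"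
    and atomless: "\<And>i c. i \<in> V \<Longrightarrow> AE x in distr M borel (X i). x \<noteq> c"
  shows "AE \<omega> in M. alg_indep V (\<lambda>i. X i \<omega>)"
proof -
  have "AE \<omega> in M. \<forall>P\<in>{P. pvars P \<subseteq> V \<and> (\<exists>z :: 'i \<Rightarrow> complex. peval z P \<noteq> 0)}. peval (\<lambda>i. X i \<omega>) P \<noteq> 0"
  proof (rule AE_ball_countable')
    fix P assume "P \<in> {P. pvars P \<subseteq> V \<and> (\<exists>z :: 'i \<Rightarrow> complex. peval z P \<noteq> 0)}"
    then obtain z :: "'i \<Rightarrow> complex" where P: "pvars P \<subseteq> V" "peval z P \<noteq> 0" by blast
    have "finite (pvars P)" by (induction P) auto
    then show "AE \<omega> in M. peval (\<lambda>i. X i \<omega>) P \<noteq> 0"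
      by (intro AE_poly_fun_nonzero[where f = "\<lambda>x. peval x P" and z = z and V = "pvars P"]
          indep_vars_subset[OF indep P(1)] atomless P(2))
        (use P(1) in \<open>auto simp: poly_fun_def\<close>)
  qed simp
  then show ?thesis unfolding alg_indep_def by (elim eventually_mono) blast
qed

section \<open>Alignment in a single block\<close>

definition psum :: "'v poly_expr list \<Rightarrow> 'v poly_expr" where
  "psum Ps = foldr PAdd Ps (PConst 0)"

lemma peval_psum: "peval x (psum Ps) = (\<Sum>P\<leftarrow>Ps. peval x P)"
  unfolding psum_def by (induction Ps) simp_all

lemma pvars_psum: "pvars (psum Ps) = (\<Union>P\<in>set Ps. pvars P)"
  unfolding psum_def by (induction Ps) simp_all

section \<open>Formal power series modulo powers of \<open>fps_X\<close>\<close>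

definition fps_agree :: "nat \<Rightarrow> 'a fps \<Rightarrow> 'a fps \<Rightarrow> bool" where
  "fps_agree n f g \<longleftrightarrow> (\<forall>m<n. fps_nth f m = fps_nth g m)"

lemma fps_agree_refl: "fps_agree n f f"
  by (simp add: fps_agree_def)

lemma fps_agree_mult:
  fixes f :: "'a::comm_ring_1 fps"
  assumes "fps_agree n f f'" "fps_agree n g g'"
  shows "fps_agree n (f * g) (f' * g')"
  unfolding fps_agree_def
proof (intro allI impI)
  fix m assume "m < n"
  then show "fps_nth (f * g) m = fps_nth (f' * g') m"
    unfolding fps_mult_nth using assms by (intro sum.cong) (auto simp: fps_agree_def)
qed

lemma fps_agree_sum:
  fixes f :: "'i \<Rightarrow> 'a::comm_ring_1 fps"
  assumes "\<And>i. i \<in> A \<Longrightarrow> fps_agree n (f i) (g i)"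
  shows "fps_agree n (sum f A) (sum g A)"
  using assms by (simp add: fps_agree_def fps_sum_nth)

lemma fps_agree_X_mult:
  fixes f :: "'a::comm_ring_1 fps"
  assumes "fps_agree n f g" shows "fps_agree (Suc n) (- (fps_X * f)) (- (fps_X * g))"
  using assms by (auto simp: fps_agree_def fps_X_mult_nth)

text \<open>The contraction principle for the \<open>X\<close>-adic metric. Each application of
  \<open>F\<close> settles one more coefficient, uniformly in the index, so coefficient
  \<open>m\<close> is final from iterate \<open>Suc m\<close> onwards.\<close>

lemma fps_contraction_fixpoint:
  fixes F :: "('i \<Rightarrow> 'a::comm_ring_1 fps) \<Rightarrow> 'i \<Rightarrow> 'a fps"
  assumes contr: "\<And>n x y i. (\<And>i. fps_agree n (x i) (y i)) \<Longrightarrow> fps_agree (Suc n) (F x i) (F y i)"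
  shows "\<exists>x. F x = x"
proof -
  define X where "X = (\<lambda>n. (F ^^ n) (\<lambda>_. 0))"
  have X_Suc: "X (Suc n) = F (X n)" for n by (simp add: X_def)
  have step: "fps_agree n (X n i) (X (Suc n) i)" for n i
  proof (induction n arbitrary: i)
    case 0
    then show ?case by (simp add: fps_agree_def)
  next
    case (Suc n)
    show ?case unfolding X_Suc[of n] X_Suc[of "Suc n"] by (rule contr) (rule Suc[unfolded X_Suc])
  qed
  have stable: "fps_nth (X (Suc m + d) i) m = fps_nth (X (Suc m) i) m" for m d i
  proof (induction d)
    case (Suc d)
    have "fps_nth (X (Suc m + d) i) m = fps_nth (X (Suc (Suc m + d)) i) m"
      using step[of "Suc m + d" i] by (simp add: fps_agree_def)
    then show ?case using Suc by simp
  qed simp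
  define x where "x = (\<lambda>i. Abs_fps (\<lambda>m. fps_nth (X (Suc m) i) m))"
  have x_X: "fps_agree n (x i) (X n i)" for n i
    unfolding fps_agree_def
  proof (intro allI impI)
    fix m assume "m < n"
    then show "fps_nth (x i) m = fps_nth (X n i) m"
      using stable[of m "n - Suc m" i] by (simp add: x_def)
  qed
  have "F x i = x i" for i
  proof (rule fps_ext)
    fix m
    have "fps_agree (Suc m) (F x i) (F (X m) i)" by (rule contr) (rule x_X)
    then show "fps_nth (F x i) m = fps_nth (x i) m"
      unfolding X_Suc[symmetric] using x_X[of "Suc m" i] by (simp add: fps_agree_def)
  qed
  then show ?thesis by blast
qed

text \<open>The channel \<open>e + X A\<close> is a formal line starting at a degenerate channel \<open>e\<close> in which every cross link
  \<open>(k, j)\<close> has a single nonzero coefficient, in row 0 or column 0. With all beams normalised to have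
  coordinate 0 equal to 1, the equation of that link then determines one remaining coordinate of
  \<open>u k\<close> or of \<open>v j\<close>, up to terms divisible by \<open>X\<close>. Assigning the link by \<open>j - k\<close> modulo \<open>K\<close> uses every
  coordinate exactly once, so that the system is a contraction in the \<open>X\<close>-adic metric.\<close>

lemma cyclic_alignment_over_fps:
  fixes A :: "nat \<Rightarrow> nat \<Rightarrow> nat \<Rightarrow> nat \<Rightarrow> complex"
  assumes Mr: "Mr \<ge> 1" and Mt: "Mt \<ge> 1" and K: "K = Mr + Mt - 1"
    and e: "\<And>k j p q. e k j p q = (if (p, q) = (if k = j then (0, 0)
        else if (j + K - k) mod K < Mr then ((j + K - k) mod K, 0)
        else (0, K - (j + K - k) mod K)) then 1 else 0)"
  shows "\<exists>U V. \<forall>k<K. \<forall>j<K.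
    (\<Sum>p<Mr. \<Sum>q<Mt. U k p * (fps_const (e k j p q) + fps_X * fps_const (A k j p q)) * V j q) = 0
      \<longleftrightarrow> k \<noteq> j"
proof -
  define u where "u = (\<lambda>x :: (nat \<times> nat) + (nat \<times> nat) \<Rightarrow> complex fps. \<lambda>k p. if p = 0 then 1 else x (Inl (k, p)))"
  define v where "v = (\<lambda>x :: (nat \<times> nat) + (nat \<times> nat) \<Rightarrow> complex fps. \<lambda>j q. if q = 0 then 1 else x (Inr (j, q)))"
  define S where "S = (\<lambda>x k j. \<Sum>p<Mr. \<Sum>q<Mt. u x k p * fps_const (A k j p q) * v x j q)"
  \<comment> \<open>With offset \<open>r = (j - k) mod K\<close>, link \<open>(k, j)\<close>
    determines coordinate \<open>r\<close> of \<open>u k\<close> if \<open>0 < r < Mr\<close>, and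
    coordinate \<open>K - r\<close> of \<open>v j\<close> if \<open>r \<ge> Mr\<close>. Since
    \<open>K = Mr + Mt - 1\<close>, the offsets from 1 to \<open>K - 1\<close> split exactly into
    \<open>Mr - 1\<close> and \<open>Mt - 1\<close> unnormalised coordinates.\<close>
  define F where "F = (\<lambda>x. case_sum (\<lambda>(k, p). - (fps_X * S x k ((k + p) mod K)))
                                    (\<lambda>(j, q). - (fps_X * S x ((j + q) mod K) j)))"
  have "\<exists>x. F x = x"
  proof (rule fps_contraction_fixpoint)
    fix n and x y :: "(nat \<times> nat) + (nat \<times> nat) \<Rightarrow> complex fps" and i
    assume xy: "\<And>i. fps_agree n (x i) (y i)"
    have "fps_agree n (u x k p) (u y k p)" "fps_agree n (v x k p) (v y k p)" for k p
      using xy by (simp_all add: u_def v_def fps_agree_refl)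
    then have "fps_agree n (S x k j) (S y k j)" for k j
      unfolding S_def by (intro fps_agree_sum fps_agree_mult fps_agree_refl)
    then show "fps_agree (Suc n) (F x i) (F y i)"
      unfolding F_def by (auto split: sum.split intro: fps_agree_X_mult)
  qed
  then obtain x where x: "F x = x" by blast
  have xl: "x (Inl (k, p)) = - (fps_X * S x k ((k + p) mod K))" for k p
    by (subst x[symmetric]) (simp add: F_def)
  have xr: "x (Inr (j, q)) = - (fps_X * S x ((j + q) mod K) j)" for j q
    by (subst x[symmetric]) (simp add: F_def)
  have "(\<Sum>p<Mr. \<Sum>q<Mt. u x k p * (fps_const (e k j p q) + fps_X * fps_const (A k j p q)) * v x j q) = 0
      \<longleftrightarrow> k \<noteq> j" if kj: "k < K" "j < K" for k j
  proof -
    define r where "r = (j + K - k) mod K"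
    obtain a b where ab: "(a, b) = (if k = j then (0, 0) else if r < Mr then (r, 0) else (0, K - r))"
      by (metis surj_pair)
    have r_eq: "r = (if k \<le> j then j - k else j + K - k)"
    proof (cases "k \<le> j")
      case True
      then have eq: "j + K - k = (j - k) + K" by simp
      show ?thesis unfolding r_def eq mod_add_self2 using True kj by simp
    qed (use kj in \<open>simp add: r_def\<close>)
    have "k + r = j \<or> k + r = j + K" "k \<noteq> j \<Longrightarrow> j + (K - r) = k \<or> j + (K - r) = k + K"
      using kj by (auto simp: r_eq)
    then have r: "r < K" "k \<noteq> j \<Longrightarrow> 0 < r" "k \<noteq> j \<Longrightarrow> (k + r) mod K = j" "k \<noteq> j \<Longrightarrow> (j + (K - r)) mod K = k"
      using kj by (auto simp: r_eq)
    have ab_less: "a < Mr" "b < Mt" using ab r K Mr Mt by (auto split: if_splits)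
    have e_ab: "e k j p q = (if p = a then if q = b then 1 else 0 else 0)" for p q
      unfolding e r_def[symmetric] ab[symmetric] by simp
    have "(\<Sum>p<Mr. \<Sum>q<Mt. u x k p * (fps_const (e k j p q) + fps_X * fps_const (A k j p q)) * v x j q)
        = (\<Sum>p<Mr. \<Sum>q<Mt. if p = a then if q = b then u x k p * v x j q else 0 else 0) + fps_X * S x k j"
      unfolding S_def sum_distrib_left sum.distrib[symmetric] e_ab
      by (intro sum.cong refl) (auto simp: algebra_simps)
    also have "(\<Sum>p<Mr. \<Sum>q<Mt. if p = a then if q = b then u x k p * v x j q else 0 else 0) = u x k a * v x j b"
    proof -
      have "(\<Sum>q<Mt. if p = a then if q = b then u x k p * v x j q else 0 else 0)
          = (if p = a then u x k p * v x j b else 0)" for p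
        using ab_less by (simp add: sum.delta)
      then show ?thesis using ab_less by (simp add: sum.delta)
    qed
    finally have eq: "(\<Sum>p<Mr. \<Sum>q<Mt. u x k p * (fps_const (e k j p q) + fps_X * fps_const (A k j p q)) * v x j q)
        = u x k a * v x j b + fps_X * S x k j" .
    show ?thesis
    proof (cases "k = j")
      case True
      \<comment> \<open>At \<open>X = 0\<close> the direct link has the single coefficient 1 at
        position \<open>(0, 0)\<close>, where both beams are normalised to 1, so the desired signal
        survives.\<close>
      then have "fps_nth (u x k a * v x j b + fps_X * S x k j) 0 = 1"
        using ab by (simp add: u_def v_def fps_X_mult_nth)
      then show ?thesis using True eq by (metis fps_zero_nth zero_neq_one)
    next
      case False
      have "u x k a * v x j b = - (fps_X * S x k j)"
      proof (cases "r < Mr")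
        case True
        then show ?thesis using ab False r xl[of k r] by (simp add: u_def v_def)
      next
        case ge: False
        then have "K - r > 0" using r by simp
        then show ?thesis using ab False ge r xr[of j "K - r"] by (simp add: u_def v_def)
      qed
      then show ?thesis using False eq by simp
    qed
  qed
  then show ?thesis by blast
qed

text \<open>An integer relation valid along the whole line holds at \<open>X = 1\<close>, that is, at \<open>c\<close>; conversely
  a relation valid at the generic point \<open>c\<close> is trivial.\<close>

lemma generic_line_same_relations:
  assumes indep: "alg_indep V c"
  shows "same_relations V (\<lambda>i. fps_const (b i) + fps_X * fps_const (c i - b i)) c"
  unfolding same_relations_def
proof (intro allI impI)
  fix P assume P: "pvars P \<subseteq> V"
  define Y where "Y = (\<lambda>i. [:b i, c i - b i:])"
  have "(\<lambda>i. fps_const (b i) + fps_X * fps_const (c i - b i)) = (\<lambda>i. fps_of_poly (Y i))"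
    by (simp add: Y_def fps_of_poly_pCons mult.commute)
  moreover have "peval (\<lambda>i. fps_of_poly (Y i)) P = fps_of_poly (peval Y P)"
    by (rule peval_hom) (simp_all add: fps_of_poly_add fps_of_poly_mult of_int_poly fps_of_poly_const fps_of_int)
  moreover have Y: "peval (\<lambda>i. poly (Y i) t) P = poly (peval Y P) t" for t
    by (rule peval_hom) (simp_all add: of_int_poly)
  have "peval Y P = 0 \<longleftrightarrow> peval c P = 0"
  proof
    assume "peval Y P = 0"
    then show "peval c P = 0" using Y[of 1] by (simp add: Y_def)
  next
    assume "peval c P = 0"
    then have "peval (\<lambda>i. poly (Y i) t) P = 0" for t using alg_indepD[OF indep P] by blast
    then have "\<forall>t. poly (peval Y P) t = 0" unfolding Y by blast
    then show "peval Y P = 0" by (simp add: poly_all_0_iff_0)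
  qed
  ultimately show "peval (\<lambda>i. fps_const (b i) + fps_X * fps_const (c i - b i)) P = 0 \<longleftrightarrow> peval c P = 0"
    by simp
qed

lemma generic_alignment:
  fixes h :: "nat \<times> nat \<times> nat \<times> nat \<Rightarrow> complex"
  assumes Mr: "Mr \<ge> 1" and Mt: "Mt \<ge> 1" and K: "K = Mr + Mt - 1"
    and indep: "alg_indep ({..<K} \<times> {..<K} \<times> {..<Mr} \<times> {..<Mt}) h"
  shows "\<exists>u v. \<forall>k<K. \<forall>j<K. (\<Sum>p<Mr. \<Sum>q<Mt. u k p * h (k, j, p, q) * v j q) = 0 \<longleftrightarrow> k \<noteq> j"
proof -
  define I where "I = {..<K} \<times> {..<K} \<times> {..<Mr} \<times> {..<Mt}"
  define e :: "nat \<Rightarrow> nat \<Rightarrow> nat \<Rightarrow> nat \<Rightarrow> complex" where "e k j p q = (if (p, q) = (if k = j then (0, 0)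
        else if (j + K - k) mod K < Mr then ((j + K - k) mod K, 0)
        else (0, K - (j + K - k) mod K)) then 1 else 0)" for k j p q
  obtain U V where UV: "\<And>k j. k < K \<Longrightarrow> j < K \<Longrightarrow>
    (\<Sum>p<Mr. \<Sum>q<Mt. U k p * (fps_const (e k j p q) + fps_X * fps_const (h (k, j, p, q) - e k j p q)) * V j q) = 0
      \<longleftrightarrow> k \<noteq> j"
    using cyclic_alignment_over_fps[OF Mr Mt K e_def, of "\<lambda>k j p q. h (k, j, p, q) - e k j p q"] by blast
  \<comment> \<open>Indices \<open>Inl\<close> stand for channel coefficients and \<open>Inr\<close>
    for beam coordinates. At \<open>Inr\<close> the values of \<open>c\<close> are placeholders,
    replaced on \<open>W\<close> through \<open>same_relations_extend\<close>.\<close>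
  define c where "c = (\<lambda>i :: (nat \<times> nat \<times> nat \<times> nat) + ((nat \<times> nat) + (nat \<times> nat)). h (projl i))"
  define b where "b = (\<lambda>i :: (nat \<times> nat \<times> nat \<times> nat) + ((nat \<times> nat) + (nat \<times> nat)).
    case projl i of (k, j, p, q) \<Rightarrow> e k j p q)"
  define a where "a = case_sum (\<lambda>i. fps_const (b (Inl i)) + fps_X * fps_const (c (Inl i) - b (Inl i)))
    (case_sum (\<lambda>(k, p). U k p) (\<lambda>(j, q). V j q))"
  have "alg_indep (Inl ` I) c"
    unfolding c_def by (rule alg_indep_reindex[OF indep]) (auto simp: I_def inj_on_def)
  then have line: "same_relations (Inl ` I) (\<lambda>i. fps_const (b i) + fps_X * fps_const (c i - b i)) c"
    by (rule generic_line_same_relations)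
  have rel: "same_relations (Inl ` I) a c"
    unfolding same_relations_def
  proof (intro allI impI)
    fix P :: "((nat \<times> nat \<times> nat \<times> nat) + ((nat \<times> nat) + (nat \<times> nat))) poly_expr"
    assume P: "pvars P \<subseteq> Inl ` I"
    have "peval a P = peval (\<lambda>i. fps_const (b i) + fps_X * fps_const (c i - b i)) P"
      by (rule peval_cong) (use P in \<open>auto simp: a_def\<close>)
    then show "peval a P = 0 \<longleftrightarrow> peval c P = 0" using same_relationsD[OF line P] by simp
  qed
  define W :: "((nat \<times> nat \<times> nat \<times> nat) + ((nat \<times> nat) + (nat \<times> nat))) set"
    where "W = Inr ` (Inl ` ({..<K} \<times> {..<Mr}) \<union> Inr ` ({..<K} \<times> {..<Mt}))"
  have finW: "finite W" by (simp add: W_def)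
  have disj: "W \<inter> Inl ` I = {}" unfolding W_def by blast
  obtain c' where c': "same_relations (W \<union> Inl ` I) a c'" "\<forall>i. i \<notin> W \<longrightarrow> c' i = c i"
    using same_relations_extend[OF finW rel disj] by blast
  have "Inl i \<notin> W" for i :: "nat \<times> nat \<times> nat \<times> nat" unfolding W_def by blast
  then have c'_h: "c' (Inl i) = h i" for i :: "nat \<times> nat \<times> nat \<times> nat"
    using c'(2) by (simp add: c_def)
  have a_simps: "a (Inl (k, j, p, q)) = fps_const (e k j p q) + fps_X * fps_const (h (k, j, p, q) - e k j p q)"
    "a (Inr (Inl (k, p))) = U k p" "a (Inr (Inr (j, q))) = V j q" for k j p q
    by (simp_all add: a_def b_def c_def)
  define Q where "Q k j = psum (map (\<lambda>p. psum (map (\<lambda>q. PMul (PMul (PVar (Inr (Inl (k, p))))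
    (PVar (Inl (k, j, p, q)))) (PVar (Inr (Inr (j, q))))) [0..<Mt])) [0..<Mr])" for k j :: nat
  have peval_Q: "peval x (Q k j) = (\<Sum>p<Mr. \<Sum>q<Mt. x (Inr (Inl (k, p))) * x (Inl (k, j, p, q)) * x (Inr (Inr (j, q))))"
    for x :: "_ \<Rightarrow> 'a::comm_ring_1" and k j
    by (simp add: Q_def peval_psum o_def interv_sum_list_conv_sum_set_nat atLeast0LessThan)
  have "(\<Sum>p<Mr. \<Sum>q<Mt. c' (Inr (Inl (k, p))) * h (k, j, p, q) * c' (Inr (Inr (j, q)))) = 0 \<longleftrightarrow> k \<noteq> j"
    if "k < K" "j < K" for k j
  proof -
    have "pvars (Q k j) \<subseteq> W \<union> Inl ` I"
      using that by (auto simp: Q_def pvars_psum W_def I_def)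
    then have "peval a (Q k j) = 0 \<longleftrightarrow> peval c' (Q k j) = 0" by (rule same_relationsD[OF c'(1)])
    moreover have "peval a (Q k j) = 0 \<longleftrightarrow> k \<noteq> j" unfolding peval_Q a_simps by (rule UV[OF that])
    ultimately show ?thesis unfolding peval_Q c'_h by blast
  qed
  then show ?thesis
    by (intro exI[of _ "\<lambda>k p. c' (Inr (Inl (k, p)))"] exI[of _ "\<lambda>j q. c' (Inr (Inr (j, q)))"]) simp
qed

section \<open>The bound on the number of users\<close>

text \<open>The coordinates of \<open>u\<close> stand for already conjugated receive beams, which
  makes alignment a polynomial condition. The set \<open>L\<close> is a parameter because the
  induction deletes blocks.\<close>

definition bilin :: "nat \<Rightarrow> nat \<Rightarrow> nat set \<Rightarrow> (nat \<times> nat \<times> nat \<times> nat \<times> nat \<Rightarrow> complex) \<Rightarrow>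
    (nat \<Rightarrow> nat \<Rightarrow> nat \<Rightarrow> complex) \<Rightarrow> (nat \<Rightarrow> nat \<Rightarrow> nat \<Rightarrow> complex) \<Rightarrow> nat \<Rightarrow> nat \<Rightarrow> complex" where
  "bilin Mr Mt L h u v k j = (\<Sum>(l, p, q)\<in>L \<times> {..<Mr} \<times> {..<Mt}. u k l p * h (k, j, l, p, q) * v j l q)"

text \<open>Supports consist of blocks rather than coordinates: two beams interact only through
  blocks that both use.\<close>

definition supp :: "nat set \<Rightarrow> nat \<Rightarrow> (nat \<Rightarrow> nat \<Rightarrow> nat \<Rightarrow> complex) \<Rightarrow> nat \<Rightarrow> nat set" where
  "supp L m u k = {l\<in>L. \<exists>p<m. u k l p \<noteq> 0}"

lemma alg_indep_subset: "alg_indep V x \<Longrightarrow> W \<subseteq> V \<Longrightarrow> alg_indep W x"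
  unfolding alg_indep_def by blast

text \<open>Normalisation costs each beam one coordinate; the additive form avoids truncated
  subtraction.\<close>

lemma card_free_coordinates:
  assumes "finite C" "finite L" "\<And>k. k \<in> C \<Longrightarrow> s k \<in> supp L m u k \<times> {..<m}"
  shows "card ((SIGMA k:C. supp L m u k \<times> {..<m}) - (\<lambda>k. (k, s k)) ` C) + card C = m * (\<Sum>k\<in>C. card (supp L m u k))"
proof -
  let ?A = "SIGMA k:C. supp L m u k \<times> {..<m}"
  have fin: "finite ?A" using assms(1,2) by (auto simp: supp_def)
  have sub: "(\<lambda>k. (k, s k)) ` C \<subseteq> ?A" 
  proof
    fix i assume "i \<in> (\<lambda>k. (k, s k)) ` C"
    then obtain k where "k \<in> C" "i = (k, s k)" by blast
    then show "i \<in> ?A" using assms(3)[of k] by simp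
  qed
  have "card ?A = m * (\<Sum>k\<in>C. card (supp L m u k))"
    using assms(1,2) by (simp add: card_SigmaI supp_def card_cartesian_product sum_distrib_left mult.commute)
  moreover have "card ((\<lambda>k. (k, s k)) ` C) = card C" by (intro card_image) (auto simp: inj_on_def)
  ultimately show ?thesis
    using card_Diff_subset[OF finite_subset[OF sub fin] sub] card_mono[OF fin sub] by simp
qed

text \<open>Every equation in \<open>E\<close> expresses one channel coefficient rationally through the remaining ones and
  the free beam coordinates. Equations between beams with disjoint supports are void, which is why
  only the supports enter the count.\<close>

lemma overdetermined_normalised:
  fixes u v :: "nat \<Rightarrow> nat \<Rightarrow> nat \<Rightarrow> complex"
  assumes fin: "finite C" "finite L"
    and indep: "alg_indep (C \<times> C \<times> L \<times> {..<Mr} \<times> {..<Mt}) h"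
    and s: "\<And>k. k \<in> C \<Longrightarrow> s k \<in> supp L Mr u k \<times> {..<Mr}" "\<And>k. k \<in> C \<Longrightarrow> case s k of (l, p) \<Rightarrow> u k l p = 1"
    and t: "\<And>j. j \<in> C \<Longrightarrow> t j \<in> supp L Mt v j \<times> {..<Mt}" "\<And>j. j \<in> C \<Longrightarrow> case t j of (l, q) \<Rightarrow> v j l q = 1"
    and E: "E = {(k, j) \<in> C \<times> C. k \<noteq> j \<and> supp L Mr u k \<inter> supp L Mt v j \<noteq> {}}"
    and zero: "\<And>k j. (k, j) \<in> E \<Longrightarrow> bilin Mr Mt L h u v k j = 0"
  shows "card E + 2 * card C \<le> Mr * (\<Sum>k\<in>C. card (supp L Mr u k)) + Mt * (\<Sum>j\<in>C. card (supp L Mt v j))"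
proof -
  define I where "I = C \<times> C \<times> L \<times> {..<Mr} \<times> {..<Mt}"
  define US where "US = (SIGMA k:C. supp L Mr u k \<times> {..<Mr}) - (\<lambda>k. (k, s k)) ` C"
  define VS where "VS = (SIGMA j:C. supp L Mt v j \<times> {..<Mt}) - (\<lambda>j. (j, t j)) ` C"
  have finI: "finite I" using fin by (simp add: I_def)
  have finE: "finite E" unfolding E by (rule finite_subset[of _ "C \<times> C"]) (use fin in auto)
  \<comment> \<open>Such a coefficient has the nonzero factor \<open>u k l p * v j l q\<close>, so
    equation \<open>(k, j)\<close> can be solved for it.\<close>
  define pivotal where "pivotal e i \<longleftrightarrow> (case e of (k, j) \<Rightarrow> case i of (l, p, q) \<Rightarrow>
      l \<in> L \<and> p < Mr \<and> q < Mt \<and> u k l p \<noteq> 0 \<and> v j l q \<noteq> 0)" for e i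
  have "\<exists>i. pivotal e i" if "e \<in> E" for e
  proof -
    obtain k j where kj: "e = (k, j)" by (cases e)
    then have "supp L Mr u k \<inter> supp L Mt v j \<noteq> {}" using that unfolding E by simp
    then obtain l where "l \<in> supp L Mr u k" "l \<in> supp L Mt v j" by blast
    then obtain p q where "l \<in> L" "p < Mr" "q < Mt" "u k l p \<noteq> 0" "v j l q \<noteq> 0" by (auto simp: supp_def)
    then show ?thesis by (intro exI[of _ "(l, p, q)"]) (simp add: kj pivotal_def)
  qed
  then obtain g where "\<And>e. e \<in> E \<Longrightarrow> pivotal e (g e)" by metis
  note g = this[unfolded pivotal_def]
  define piv where "piv = (\<lambda>(k, j). (k, j, g (k, j)))"
  have piv_I: "piv ` E \<subseteq> I"
  proof
    fix i assume "i \<in> piv ` E"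
    then obtain k j where kj: "(k, j) \<in> E" "i = (k, j, g (k, j))" by (auto simp: piv_def)
    then show "i \<in> I" using g[OF kj(1)] E unfolding I_def by auto
  qed
  have card_piv: "card (piv ` E) = card E" by (intro card_image) (auto simp: inj_on_def piv_def)
  define J where "J = Inl ` (I - piv ` E) \<union> Inr ` (Inl ` US \<union> Inr ` VS)"
  define x where "x = case_sum h (case_sum (\<lambda>(k, l, p). u k l p) (\<lambda>(j, l, q). v j l q))"
  have finUS: "finite US" and finVS: "finite VS"
    unfolding US_def VS_def using fin by (auto simp: supp_def)
  have finJ: "finite J" unfolding J_def using finI finUS finVS by simp
  have "card (Inl ` US \<union> Inr ` VS) = card US + card VS"
    using finUS finVS by (subst card_Un_disjoint) (auto simp: card_image)
  then have "card J = card (I - piv ` E) + (card US + card VS)"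
    unfolding J_def using finI finUS finVS by (subst card_Un_disjoint) (auto simp: card_image)
  \<comment> \<open>Every equation removes one channel coefficient from the generators, so
    \<open>card I \<le> card J\<close> will say that equations do not outnumber free beam
    coordinates.\<close>
  then have card_J: "card J + card E = card I + card US + card VS"
    using card_Diff_subset[OF finite_subset[OF piv_I finI] piv_I] card_mono[OF finI piv_I] card_piv by simp
  have u_gen: "u k l p \<in> ring_gen J x" if "k \<in> C" "l \<in> L" "p < Mr" for k l p
  proof -
    have "u k l p = 0 \<or> (l, p) = s k \<or> (k, l, p) \<in> US"
      using that unfolding US_def supp_def by auto
    then consider "u k l p = 0" | "(l, p) = s k" | "(k, l, p) \<in> US" by blast
    then show ?thesis
    proof cases
      case 1
      then show ?thesis using ring_gen_of_int[of 0 J x] by simp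
    next
      case 2
      then show ?thesis using ring_gen_of_int[of 1 J x] s(2)[OF that(1)] by (auto split: prod.splits)
    next
      case 3
      then have "Inr (Inl (k, l, p)) \<in> J" by (simp add: J_def)
      from ring_gen_var[OF this, of x] show ?thesis by (simp add: x_def)
    qed
  qed
  have v_gen: "v j l q \<in> ring_gen J x" if "j \<in> C" "l \<in> L" "q < Mt" for j l q
  proof -
    have "v j l q = 0 \<or> (l, q) = t j \<or> (j, l, q) \<in> VS"
      using that unfolding VS_def supp_def by auto
    then consider "v j l q = 0" | "(l, q) = t j" | "(j, l, q) \<in> VS" by blast
    then show ?thesis
    proof cases
      case 1
      then show ?thesis using ring_gen_of_int[of 0 J x] by simp
    next
      case 2
      then show ?thesis using ring_gen_of_int[of 1 J x] t(2)[OF that(1)] by (auto split: prod.splits)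
    next
      case 3
      then have "Inr (Inr (j, l, q)) \<in> J" by (simp add: J_def)
      from ring_gen_var[OF this, of x] show ?thesis by (simp add: x_def)
    qed
  qed
  have h_gen: "h i \<in> ring_gen J x" if "i \<in> I - piv ` E" for i
  proof -
    have "Inl i \<in> J" using that by (simp add: J_def)
    from ring_gen_var[OF this, of x] show ?thesis by (simp add: x_def)
  qed
  define D where "D = (\<lambda>(k, j). case g (k, j) of (l, p, q) \<Rightarrow> u k l p * v j l q)"
  have D_gen: "D e \<in> ring_gen J x" and D_nz: "D e \<noteq> 0" if "e \<in> E" for e
    using g[OF that] that E by (auto simp: D_def split: prod.splits intro!: ring_gen_mult u_gen v_gen)
  have pivot: "D (k, j) * h (piv (k, j)) \<in> ring_gen J x" if kj: "(k, j) \<in> E" for k j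
  proof -
    obtain l p q where lpq: "g (k, j) = (l, p, q)" by (metis prod_cases3)
    have C: "k \<in> C" "j \<in> C" using kj E by auto
    have mem: "(l, p, q) \<in> L \<times> {..<Mr} \<times> {..<Mt}" using g[OF kj] lpq by auto
    have "bilin Mr Mt L h u v k j = u k l p * h (k, j, l, p, q) * v j l q
        + (\<Sum>(l, p, q)\<in>L \<times> {..<Mr} \<times> {..<Mt} - {(l, p, q)}. u k l p * h (k, j, l, p, q) * v j l q)"
      unfolding bilin_def by (subst sum.remove[OF _ mem]) (use fin in auto)
    then have "D (k, j) * h (piv (k, j))
        = - (\<Sum>(l, p, q)\<in>L \<times> {..<Mr} \<times> {..<Mt} - {(l, p, q)}. u k l p * h (k, j, l, p, q) * v j l q)"
      using zero[OF kj] by (simp add: D_def piv_def lpq algebra_simps add_eq_0_iff)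
    also have "\<dots> \<in> ring_gen J x"
    proof (intro ring_gen_uminus ring_gen_sum)
      show "finite (L \<times> {..<Mr} \<times> {..<Mt} - {(l, p, q)})" using fin by simp
      fix i assume i: "i \<in> L \<times> {..<Mr} \<times> {..<Mt} - {(l, p, q)}"
      obtain l' p' q' where [simp]: "i = (l', p', q')" by (metis prod_cases3)
      \<comment> \<open>Pivots of other equations carry a different pair of users, so no equation
        contains a pivot other than its own.\<close>
      have "(k, j, l', p', q') \<in> I - piv ` E" using i C lpq by (auto simp: I_def piv_def)
      then show "(case i of (l, p, q) \<Rightarrow> u k l p * h (k, j, l, p, q) * v j l q) \<in> ring_gen J x"
        using i C by (auto intro!: ring_gen_mult u_gen v_gen h_gen)
    qed
    finally show ?thesis .
  qed
  have "(\<Prod>e\<in>E. D e) * h i \<in> ring_gen J x" if i: "i \<in> I" for i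
  proof (cases "i \<in> piv ` E")
    case True
    then obtain k j where kj: "(k, j) \<in> E" "i = piv (k, j)" by auto
    have "(\<Prod>e\<in>E. D e) * h i = (\<Prod>e\<in>E - {(k, j)}. D e) * (D (k, j) * h (piv (k, j)))"
      using kj finE by (simp add: prod.remove[OF finE kj(1)])
    also have "\<dots> \<in> ring_gen J x"
      by (intro ring_gen_mult ring_gen_prod pivot kj(1) D_gen) (use finE in auto)
    finally show ?thesis .
  next
    case False
    then show ?thesis using i by (intro ring_gen_mult ring_gen_prod h_gen D_gen finE) auto
  qed
  then have "card I \<le> card J"
    by (intro alg_indep_card_le[OF finJ finI, of "\<Prod>e\<in>E. D e" x h] ring_gen_prod finE D_gen)
      (use D_nz finE indep in \<open>auto simp: I_def\<close>)
  then have "card E \<le> card US + card VS" using card_J by simp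
  moreover have "card US + card C = Mr * (\<Sum>k\<in>C. card (supp L Mr u k))"
    unfolding US_def by (rule card_free_coordinates[OF fin s(1)])
  moreover have "card VS + card C = Mt * (\<Sum>j\<in>C. card (supp L Mt v j))"
    unfolding VS_def by (rule card_free_coordinates[OF fin t(1)])
  ultimately show ?thesis by simp
qed

lemma exists_pivot:
  "supp L m u k \<noteq> {} \<Longrightarrow> \<exists>s. s \<in> supp L m u k \<times> {..<m} \<and> (case s of (l, p) \<Rightarrow> u k l p \<noteq> 0)"
  unfolding supp_def by fastforce

text \<open>Rescaling beams by nonzero numbers preserves supports and the zeros of the equations, so
  a nonzero coordinate of each beam may be made 1.\<close>

lemma overdetermined:
  fixes u v :: "nat \<Rightarrow> nat \<Rightarrow> nat \<Rightarrow> complex"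
  assumes fin: "finite C" "finite L"
    and indep: "alg_indep (C \<times> C \<times> L \<times> {..<Mr} \<times> {..<Mt}) h"
    and ne: "\<And>k. k \<in> C \<Longrightarrow> supp L Mr u k \<noteq> {}" "\<And>j. j \<in> C \<Longrightarrow> supp L Mt v j \<noteq> {}"
    and E: "E = {(k, j) \<in> C \<times> C. k \<noteq> j \<and> supp L Mr u k \<inter> supp L Mt v j \<noteq> {}}"
    and zero: "\<And>k j. (k, j) \<in> E \<Longrightarrow> bilin Mr Mt L h u v k j = 0"
  shows "card E + 2 * card C \<le> Mr * (\<Sum>k\<in>C. card (supp L Mr u k)) + Mt * (\<Sum>j\<in>C. card (supp L Mt v j))"
proof -
  obtain s where s: "\<And>k. k \<in> C \<Longrightarrow> s k \<in> supp L Mr u k \<times> {..<Mr} \<and> (case s k of (l, p) \<Rightarrow> u k l p \<noteq> 0)"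
    using exists_pivot[OF ne(1)] by metis
  obtain t where t: "\<And>j. j \<in> C \<Longrightarrow> t j \<in> supp L Mt v j \<times> {..<Mt} \<and> (case t j of (l, q) \<Rightarrow> v j l q \<noteq> 0)"
    using exists_pivot[OF ne(2)] by metis
  define a where "a = (\<lambda>k. if k \<in> C then inverse (case s k of (l, p) \<Rightarrow> u k l p) else 1)"
  define b where "b = (\<lambda>j. if j \<in> C then inverse (case t j of (l, q) \<Rightarrow> v j l q) else 1)"
  define u' v' where "u' = (\<lambda>k l p. a k * u k l p)" and "v' = (\<lambda>j l q. b j * v j l q)"
  have nz: "a k \<noteq> 0" "b k \<noteq> 0" for k
    using s[of k] t[of k] by (auto simp: a_def b_def split: prod.splits)
  have supp_eq: "supp L Mr u' k = supp L Mr u k" "supp L Mt v' k = supp L Mt v k" for k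
    by (simp_all add: supp_def u'_def v'_def nz)
  have bilin_eq: "bilin Mr Mt L h u' v' k j = a k * b j * bilin Mr Mt L h u v k j" for k j
    unfolding bilin_def sum_distrib_left by (intro sum.cong) (auto simp: u'_def v'_def)
  show ?thesis
    unfolding supp_eq[symmetric]
  proof (rule overdetermined_normalised[OF fin indep])
    show "s k \<in> supp L Mr u' k \<times> {..<Mr}" if "k \<in> C" for k using s[OF that] by (simp add: supp_eq)
    show "case s k of (l, p) \<Rightarrow> u' k l p = 1" if "k \<in> C" for k
      using s[OF that] that by (auto simp: u'_def a_def split: prod.splits)
    show "t k \<in> supp L Mt v' k \<times> {..<Mt}" if "k \<in> C" for k using t[OF that] by (simp add: supp_eq)
    show "case t k of (l, p) \<Rightarrow> v' k l p = 1" if "k \<in> C" for k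
      using t[OF that] that by (auto simp: v'_def b_def split: prod.splits)
    show "E = {(k, j) \<in> C \<times> C. k \<noteq> j \<and> supp L Mr u' k \<inter> supp L Mt v' j \<noteq> {}}"
      unfolding supp_eq by (rule E)
    show "bilin Mr Mt L h u' v' k j = 0" if "(k, j) \<in> E" for k j
      using zero[OF that] by (simp add: bilin_eq)
  qed
qed

text \<open>Users whose transmit beam vanishes on the support \<open>S k\<close> of a receive beam form a scheme on the
  remaining blocks, so by induction there are few of them and the other users interfere with \<open>k\<close>.
  The same holds with the roles of transmitters and receivers exchanged, and averaging the two
  counts with weights \<open>Mr\<close> and \<open>Mt\<close> yields more equations than \<open>overdetermined\<close> allows.\<close>

lemma alignment_user_bound:
  fixes u v :: "nat \<Rightarrow> nat \<Rightarrow> nat \<Rightarrow> complex"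
  assumes "finite L" "finite C" "C \<noteq> {}"
    and indep: "alg_indep V h" "C \<times> C \<times> L \<times> {..<Mr} \<times> {..<Mt} \<subseteq> V"
    and align: "\<And>k j. k \<in> C \<Longrightarrow> j \<in> C \<Longrightarrow> bilin Mr Mt L h u v k j = 0 \<longleftrightarrow> k \<noteq> j"
  shows "card C < (Mr + Mt) * card L"
  using assms(1-3,5,6)
proof (induction L arbitrary: C rule: finite_psubset_induct)
  case (psubset L)
  define n where "n = Mr + Mt"
  define S R where "S = supp L Mr u" and "R = supp L Mt v"
  have finS: "finite (S k)" and finR: "finite (R k)" and subS: "S k \<subseteq> L" and subR: "R k \<subseteq> L" for k
    using psubset.hyps by (auto simp: S_def R_def supp_def)
  have SR: "S k \<inter> R k \<noteq> {}" if "k \<in> C" for k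
  proof
    assume empty: "S k \<inter> R k = {}"
    have "bilin Mr Mt L h u v k k = 0" unfolding bilin_def
      by (rule sum.neutral) (use empty in \<open>auto simp: S_def R_def supp_def\<close>)
    then show False using psubset.prems(4) that by blast
  qed
  \<comment> \<open>Blocks in \<open>A\<close> contribute nothing to any product and can be deleted.
    The strict bound is relaxed to admit empty \<open>C'\<close>.\<close>
  have IH: "card C' \<le> n * card (L - A)"
    if A: "A \<subseteq> L" "A \<noteq> {}" and C': "C' \<subseteq> C"
      and van: "\<And>k j l p q. k \<in> C' \<Longrightarrow> j \<in> C' \<Longrightarrow> l \<in> A \<Longrightarrow> p < Mr \<Longrightarrow> q < Mt \<Longrightarrow> u k l p = 0 \<or> v j l q = 0"
    for A C'
  proof (cases "C' = {}")
    case False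
    have "bilin Mr Mt (L - A) h u v k j = bilin Mr Mt L h u v k j" if kj: "k \<in> C'" "j \<in> C'" for k j
    proof -
      have "u k l p * h (k, j, l, p, q) * v j l q = 0" if "l \<in> A" "p < Mr" "q < Mt" for l p q
        using van[OF kj that] by auto
      then show ?thesis unfolding bilin_def
        by (intro sum.mono_neutral_left) (use psubset.hyps in auto)
    qed
    then have "bilin Mr Mt (L - A) h u v k j = 0 \<longleftrightarrow> k \<noteq> j" if "k \<in> C'" "j \<in> C'" for k j
      using psubset.prems(4) C' that by (metis subsetD)
    moreover have "C' \<times> C' \<times> (L - A) \<times> {..<Mr} \<times> {..<Mt} \<subseteq> V"
      by (rule order_trans[OF _ psubset.prems(3)]) (use C' in auto)
    ultimately have "card C' < (Mr + Mt) * card (L - A)"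
      using A by (intro psubset.IH False finite_subset[OF C' psubset.prems(1)]) auto
    then show ?thesis by (simp add: n_def)
  qed simp
  \<comment> \<open>In both applications \<open>N\<close> collects the users whose beam misses
    \<open>A\<close>. At least \<open>n * card A\<close> users of \<open>C\<close> lie outside
    \<open>N\<close>, and the \<open>Suc\<close> accounts for \<open>k\<close> itself.\<close>
  have slice: "n * card A \<le> Suc (card {j \<in> C. j \<noteq> k \<and> j \<notin> N})"
    if ge: "n * card L \<le> card C" and A: "A \<subseteq> L" and k: "k \<in> C" and N: "card N \<le> n * card (L - A)" "finite N" for A k N
  proof -
    have "card C \<le> card (insert k ({j \<in> C. j \<noteq> k \<and> j \<notin> N} \<union> N))"
      by (rule card_mono) (use N psubset.prems(1) in auto)
    also have "\<dots> \<le> Suc (card ({j \<in> C. j \<noteq> k \<and> j \<notin> N} \<union> N))" by (rule card_insert_le_m1) auto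
    also have "\<dots> \<le> Suc (card {j \<in> C. j \<noteq> k \<and> j \<notin> N} + card N)" by (simp add: card_Un_le)
    finally have "n * card L \<le> Suc (card {j \<in> C. j \<noteq> k \<and> j \<notin> N}) + n * card (L - A)" using ge N(1) by simp
    moreover have "n * card L = n * card (L - A) + n * card A"
    proof -
      have "card L = card (L - A) + card A"
        using card_Diff_subset[OF finite_subset[OF A psubset.hyps] A] card_mono[OF psubset.hyps A] by simp
      then show ?thesis by (simp add: distrib_left)
    qed
    ultimately show ?thesis by simp
  qed
  show ?case
  proof (rule ccontr)
    assume "\<not> card C < (Mr + Mt) * card L"
    then have ge: "n * card L \<le> card C" by (simp add: n_def)
    define E where "E = {(k, j) \<in> C \<times> C. k \<noteq> j \<and> S k \<inter> R j \<noteq> {}}"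
    define out where "out = (\<lambda>k. {j \<in> C. j \<noteq> k \<and> S k \<inter> R j \<noteq> {}})"
    define inn where "inn = (\<lambda>j. {k \<in> C. k \<noteq> j \<and> S k \<inter> R j \<noteq> {}})"
    have fin_oi: "finite (out k)" "finite (inn k)" for k using psubset.prems(1) by (auto simp: out_def inn_def)
    have out: "n * card (S k) \<le> Suc (card (out k))" if k: "k \<in> C" for k
    proof -
      define N where "N = {j \<in> C. S k \<inter> R j = {}}"
      have "card N \<le> n * card (L - S k)"
        by (rule IH) (use SR[OF k] subS in \<open>auto simp: N_def S_def R_def supp_def\<close>)
      then have "n * card (S k) \<le> Suc (card {j \<in> C. j \<noteq> k \<and> j \<notin> N})"
        by (rule slice[OF ge subS k]) (use psubset.prems(1) in \<open>simp add: N_def\<close>)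
      also have "{j \<in> C. j \<noteq> k \<and> j \<notin> N} = out k" by (auto simp: out_def N_def)
      finally show ?thesis .
    qed
    have inn: "n * card (R j) \<le> Suc (card (inn j))" if j: "j \<in> C" for j
    proof -
      define N where "N = {k \<in> C. S k \<inter> R j = {}}"
      have "card N \<le> n * card (L - R j)"
        by (rule IH) (use SR[OF j] subR in \<open>auto simp: N_def S_def R_def supp_def\<close>)
      then have "n * card (R j) \<le> Suc (card {k \<in> C. k \<noteq> j \<and> k \<notin> N})"
        by (rule slice[OF ge subR j]) (use psubset.prems(1) in \<open>simp add: N_def\<close>)
      also have "{k \<in> C. k \<noteq> j \<and> k \<notin> N} = inn j" by (auto simp: inn_def N_def)
      finally show ?thesis .
    qed
    have "E = (SIGMA k:C. out k)" by (auto simp: E_def out_def)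
    then have E_out: "card E = (\<Sum>k\<in>C. card (out k))" using psubset.prems(1) fin_oi by simp
    have "E = prod.swap ` (SIGMA j:C. inn j)" by (force simp: E_def inn_def)
    then have "card E = card (SIGMA j:C. inn j)" by (simp add: card_image)
    then have E_inn: "card E = (\<Sum>j\<in>C. card (inn j))" using psubset.prems(1) fin_oi by simp
    have "n * (\<Sum>k\<in>C. card (S k)) \<le> (\<Sum>k\<in>C. Suc (card (out k)))"
      unfolding sum_distrib_left by (rule sum_mono) (rule out)
    then have S_le: "n * (\<Sum>k\<in>C. card (S k)) \<le> card E + card C" by (simp only: sum_Suc E_out)
    have "n * (\<Sum>k\<in>C. card (R k)) \<le> (\<Sum>k\<in>C. Suc (card (inn k)))"
      unfolding sum_distrib_left by (rule sum_mono) (rule inn)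
    then have R_le: "n * (\<Sum>k\<in>C. card (R k)) \<le> card E + card C" by (simp only: sum_Suc E_inn)
    have "card E + 2 * card C \<le> Mr * (\<Sum>k\<in>C. card (S k)) + Mt * (\<Sum>j\<in>C. card (R j))"
      unfolding S_def R_def
    proof (rule overdetermined[OF psubset.prems(1) psubset.hyps alg_indep_subset[OF indep(1) psubset.prems(3)]])
      show "supp L Mr u k \<noteq> {}" "supp L Mt v k \<noteq> {}" if "k \<in> C" for k
        using SR[OF that] by (auto simp: S_def R_def)
      show "E = {(k, j) \<in> C \<times> C. k \<noteq> j \<and> supp L Mr u k \<inter> supp L Mt v j \<noteq> {}}"
        by (simp add: E_def S_def R_def)
      show "bilin Mr Mt L h u v k j = 0" if "(k, j) \<in> E" for k j
        using that psubset.prems(4) by (simp add: E_def)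
    qed
    \<comment> \<open>The factor \<open>n\<close> lets both sums be bounded by
      \<open>card E + card C\<close>. The outcome
      \<open>n * (card E + 2 * card C) \<le> n * (card E + card C)\<close> leaves only
      \<open>n * card C = 0\<close>.\<close>
    then have "n * (card E + 2 * card C) \<le> n * (Mr * (\<Sum>k\<in>C. card (S k)) + Mt * (\<Sum>j\<in>C. card (R j)))"
      by (rule mult_le_mono2)
    also have "\<dots> = Mr * (n * (\<Sum>k\<in>C. card (S k))) + Mt * (n * (\<Sum>j\<in>C. card (R j)))"
      by (simp only: distrib_left mult.left_commute)
    also have "\<dots> \<le> Mr * (card E + card C) + Mt * (card E + card C)"
      by (intro add_mono mult_le_mono2 S_le R_le)
    also have "\<dots> = n * (card E + card C)" by (simp add: n_def algebra_simps)
    finally have "n * card C = 0" by (auto simp: algebra_simps)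
    moreover have "card C > 0" using psubset.prems(1,2) by (simp add: card_gt_0_iff)
    moreover have "n > 0"
    proof -
      obtain k where "k \<in> C" using psubset.prems(2) by blast
      then obtain l where "l \<in> S k" using SR by blast
      then show ?thesis by (auto simp: S_def supp_def n_def)
    qed
    ultimately show False by simp
  qed
qed

section \<open>Block diagonal channels\<close>

text \<open>The induction splits off the last block, turning the matrix into a 2 by 2 block matrix
  with zero corners.\<close>

lemma channel_matrix_index:
  assumes "l < T" "l' < T" "p < Mr" "q < Mt"
  shows "channel_matrix Mr Mt T h $$ (l * Mr + p, l' * Mt + q) = (if l = l' then h l p q else 0)"
  using assms(1,2)
proof (induction T)
  case 0
  then show ?case by simp
next
  case (Suc T)
  define A B where "A = channel_matrix Mr Mt T h" and "B = Matrix.mat Mr Mt (\<lambda>(p, q). h T p q)"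
  have dim: "dim_row A = Mr * T" "dim_col A = Mt * T" "dim_row B = Mr" "dim_col B = Mt"
    using channel_matrix_carrier[of Mr Mt T h] by (auto simp: A_def B_def)
  have eq: "channel_matrix Mr Mt (Suc T) h
      = four_block_mat A (0\<^sub>m (dim_row A) (dim_col B)) (0\<^sub>m (dim_row B) (dim_col A)) B"
    by (simp add: channel_matrix_def A_def B_def diag_block_mat_last Let_def)
  \<comment> \<open>This decides in which of the four quadrants an index lies.\<close>
  have bound: "m * n + r < n * T \<longleftrightarrow> m < T" "m * n + r < n * T + n"
    if "m < Suc T" "r < n" for m n r :: nat
  proof -
    have lt: "m * n + r < n * T" if "m < T"
    proof -
      have "m * n + r < Suc m * n" using \<open>r < n\<close> by simp
      also have "\<dots> \<le> T * n" using that by (intro mult_le_mono1) simp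
      finally show ?thesis by (simp add: mult.commute)
    qed
    then show "m * n + r < n * T \<longleftrightarrow> m < T" using that by (auto simp: less_Suc_eq mult.commute)
    show "m * n + r < n * T + n" using lt that by (auto simp: less_Suc_eq mult.commute)
  qed
  have index: "channel_matrix Mr Mt (Suc T) h $$ (l * Mr + p, l' * Mt + q) =
    (if l < T then if l' < T then A $$ (l * Mr + p, l' * Mt + q) else 0
     else if l' < T then 0 else B $$ (l * Mr + p - Mr * T, l' * Mt + q - Mt * T))"
    unfolding eq using Suc.prems assms(3,4) bound[of l p Mr] bound[of l' q Mt]
    by (subst index_mat_four_block) (auto simp: dim)
  show ?case
  proof (cases "l < T \<and> l' < T")
    case True
    then show ?thesis using Suc.IH unfolding index A_def by simp
  next
    case False
    then show ?thesis using Suc.prems assms(3,4) unfolding index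
      by (auto simp: less_Suc_eq B_def mult.commute)
  qed
qed

lemma sum_blocks: "(\<Sum>i<n * T. f i) = (\<Sum>l<T. \<Sum>p<n. f (l * n + p))" for f :: "nat \<Rightarrow> 'a::comm_monoid_add"
proof (induction T)
  case (Suc T)
  have "(\<Sum>i<n * T + m. f i) = (\<Sum>i<n * T. f i) + (\<Sum>p<m. f (T * n + p))" for m
    by (induction m) (simp_all add: add.assoc mult.commute)
  then show ?case using Suc by (simp add: add.commute)
qed simp

lemma scalar_prod_channel_matrix:
  assumes "u \<in> carrier_vec (Mr * T)" "v \<in> carrier_vec (Mt * T)"
  shows "scalar_prod (conjugate u) (channel_matrix Mr Mt T h *\<^sub>v v) =
    (\<Sum>(l, p, q)\<in>{..<T} \<times> {..<Mr} \<times> {..<Mt}. cnj (vec_index u (l * Mr + p)) * h l p q * vec_index v (l * Mt + q))"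
proof -
  define H where "H = channel_matrix Mr Mt T h"
  have dim: "dim_row H = Mr * T" "dim_col H = Mt * T" "dim_vec u = Mr * T" "dim_vec v = Mt * T"
    using channel_matrix_carrier[of Mr Mt T h] assms by (auto simp: H_def)
  have "scalar_prod (conjugate u) (H *\<^sub>v v) = (\<Sum>i<Mr * T. cnj (vec_index u i) * (\<Sum>j<Mt * T. H $$ (i, j) * vec_index v j))"
    by (simp add: scalar_prod_def dim atLeast0LessThan)
  also have "\<dots> = (\<Sum>l<T. \<Sum>p<Mr. cnj (vec_index u (l * Mr + p)) *
      (\<Sum>l'<T. \<Sum>q<Mt. H $$ (l * Mr + p, l' * Mt + q) * vec_index v (l' * Mt + q)))"
    by (simp only: sum_blocks)
  also have "\<dots> = (\<Sum>l<T. \<Sum>p<Mr. cnj (vec_index u (l * Mr + p)) * (\<Sum>q<Mt. h l p q * vec_index v (l * Mt + q)))"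
  proof (intro sum.cong refl)
    fix l p assume lp: "l \<in> {..<T}" "p \<in> {..<Mr}"
    have "(\<Sum>l'<T. \<Sum>q<Mt. H $$ (l * Mr + p, l' * Mt + q) * vec_index v (l' * Mt + q))
        = (\<Sum>l'<T. if l = l' then \<Sum>q<Mt. h l p q * vec_index v (l * Mt + q) else 0)"
      using lp by (intro sum.cong refl) (auto simp: H_def channel_matrix_index)
    also have "\<dots> = (\<Sum>q<Mt. h l p q * vec_index v (l * Mt + q))" using lp by simp
    finally show "cnj (vec_index u (l * Mr + p)) *
        (\<Sum>l'<T. \<Sum>q<Mt. H $$ (l * Mr + p, l' * Mt + q) * vec_index v (l' * Mt + q))
      = cnj (vec_index u (l * Mr + p)) * (\<Sum>q<Mt. h l p q * vec_index v (l * Mt + q))" by simp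
  qed
  also have "\<dots> = (\<Sum>(l, p, q)\<in>{..<T} \<times> {..<Mr} \<times> {..<Mt}.
      cnj (vec_index u (l * Mr + p)) * h l p q * vec_index v (l * Mt + q))"
    by (simp add: sum_distrib_left sum.cartesian_product[symmetric] mult.assoc)
  finally show ?thesis unfolding H_def .
qed

text \<open>Conjugation is a bijection on receive beams, so absorbing it into \<open>u\<close> does
  not affect existence.\<close>

lemma single_beam_feasible_iff:
  assumes H: "\<And>k j. H k j = channel_matrix Mr Mt T (\<lambda>l p q. h (k, j, l, p, q))"
  shows "single_beam_feasible Mr Mt T H K \<longleftrightarrow>
    (\<exists>u v. \<forall>k<K. \<forall>j<K. bilin Mr Mt {..<T} h u v k j = 0 \<longleftrightarrow> k \<noteq> j)"
proof
  assume "single_beam_feasible Mr Mt T H K"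
  then obtain v u where uv: "single_beam_IA_scheme Mr Mt T H K v u"
    unfolding single_beam_feasible_def by blast
  define u' v' where "u' = (\<lambda>k l p. cnj (vec_index (u k) (l * Mr + p)))" and "v' = (\<lambda>j l q. vec_index (v j) (l * Mt + q))"
  have "scalar_prod (conjugate (u k)) (H k j *\<^sub>v v j) = bilin Mr Mt {..<T} h u' v' k j" if "k < K" "j < K" for k j
    using uv that unfolding single_beam_IA_scheme_def H bilin_def u'_def v'_def
    by (subst scalar_prod_channel_matrix) auto
  then have "\<forall>k<K. \<forall>j<K. bilin Mr Mt {..<T} h u' v' k j = 0 \<longleftrightarrow> k \<noteq> j"
    using uv unfolding single_beam_IA_scheme_def by metis
  then show "\<exists>u v. \<forall>k<K. \<forall>j<K. bilin Mr Mt {..<T} h u v k j = 0 \<longleftrightarrow> k \<noteq> j" by blast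
next
  assume "\<exists>u v. \<forall>k<K. \<forall>j<K. bilin Mr Mt {..<T} h u v k j = 0 \<longleftrightarrow> k \<noteq> j"
  then obtain u v where uv: "\<forall>k<K. \<forall>j<K. bilin Mr Mt {..<T} h u v k j = 0 \<longleftrightarrow> k \<noteq> j" by blast
  define u' v' where "u' = (\<lambda>k. Matrix.vec (Mr * T) (\<lambda>i. cnj (u k (i div Mr) (i mod Mr))))"
    and "v' = (\<lambda>j. Matrix.vec (Mt * T) (\<lambda>i. v j (i div Mt) (i mod Mt)))"
  have less: "l * n + r < n * T" if "l < T" "r < n" for l n r
  proof -
    have "l * n + r < Suc l * n" using that by simp
    also have "\<dots> \<le> T * n" using that by (intro mult_le_mono1) simp
    finally show ?thesis by (simp add: mult.commute)
  qed
  have eq: "scalar_prod (conjugate (u' k)) (H k j *\<^sub>v v' j) = bilin Mr Mt {..<T} h u v k j" for k j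
  proof -
    have "scalar_prod (conjugate (u' k)) (H k j *\<^sub>v v' j) = (\<Sum>(l, p, q)\<in>{..<T} \<times> {..<Mr} \<times> {..<Mt}.
        cnj (vec_index (u' k) (l * Mr + p)) * h (k, j, l, p, q) * vec_index (v' j) (l * Mt + q))"
      unfolding H by (rule scalar_prod_channel_matrix) (simp_all add: u'_def v'_def)
    also have "\<dots> = bilin Mr Mt {..<T} h u v k j"
      unfolding bilin_def by (intro sum.cong refl) (auto simp: u'_def v'_def less)
    finally show ?thesis .
  qed
  have "single_beam_IA_scheme Mr Mt T H K v' u'"
    unfolding single_beam_IA_scheme_def eq using uv by (simp add: u'_def v'_def)
  then show "single_beam_feasible Mr Mt T H K" unfolding single_beam_feasible_def by blast
qed

text \<open>Users of different groups have beams on disjoint blocks and do not interfere whatever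
  the channel. Genericity serves only alignment within a group, and subfamilies inherit it.\<close>

lemma generic_block_alignment:
  assumes Mr: "Mr \<ge> 1" and Mt: "Mt \<ge> 1"
    and indep: "alg_indep (UNIV \<times> UNIV \<times> {..<T} \<times> {..<Mr} \<times> {..<Mt}) h"
  shows "\<exists>u v. \<forall>k<(Mr + Mt - 1) * T. \<forall>j<(Mr + Mt - 1) * T. bilin Mr Mt {..<T} h u v k j = 0 \<longleftrightarrow> k \<noteq> j"
proof -
  define N where "N = Mr + Mt - 1"
  have N: "N > 0" using Mr Mt by (simp add: N_def)
  define aligned where "aligned g uv \<longleftrightarrow> (\<forall>k<N. \<forall>j<N.
    (\<Sum>p<Mr. \<Sum>q<Mt. fst uv k p * h (g * N + k, g * N + j, g, p, q) * snd uv j q) = 0 \<longleftrightarrow> k \<noteq> j)" for g uv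
  have "\<exists>uv. aligned g uv" if g: "g < T" for g
  proof -
    have "alg_indep ({..<N} \<times> {..<N} \<times> {..<Mr} \<times> {..<Mt})
        (\<lambda>i. h ((\<lambda>(k, j, p, q). (g * N + k, g * N + j, g, p, q)) i))"
      by (rule alg_indep_reindex[OF indep]) (use g in \<open>auto simp: inj_on_def\<close>)
    from generic_alignment[OF Mr Mt N_def this] show ?thesis unfolding aligned_def by simp
  qed
  then obtain w where "\<And>g. g < T \<Longrightarrow> aligned g (w g)" by metis
  note w = this[unfolded aligned_def, rule_format]
  define u where "u = (\<lambda>k l p. if l = k div N then fst (w l) (k mod N) p else 0)"
  define v where "v = (\<lambda>j l q. if l = j div N then snd (w l) (j mod N) q else 0)"
  have "bilin Mr Mt {..<T} h u v k j = 0 \<longleftrightarrow> k \<noteq> j" if "k < N * T" "j < N * T" for k j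
  proof -
    have T: "k div N < T" "j div N < T" using that by (simp_all add: less_mult_imp_div_less mult.commute)
    have "bilin Mr Mt {..<T} h u v k j = (\<Sum>l<T. \<Sum>p<Mr. \<Sum>q<Mt. u k l p * h (k, j, l, p, q) * v j l q)"
      by (simp add: bilin_def sum.cartesian_product[symmetric])
    also have "\<dots> = (\<Sum>l<T. if l = k div N then \<Sum>p<Mr. \<Sum>q<Mt. u k l p * h (k, j, l, p, q) * v j l q else 0)"
      by (intro sum.cong refl) (simp add: u_def)
    also have "\<dots> = (\<Sum>p<Mr. \<Sum>q<Mt. u k (k div N) p * h (k, j, k div N, p, q) * v j (k div N) q)"
      using T by simp
    finally have eq: "bilin Mr Mt {..<T} h u v k j = \<dots>" .
    show ?thesis
    proof (cases "k div N = j div N")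
      case True
      have "k div N * N + k mod N = k" by simp
      moreover have "k div N * N + j mod N = j" by (simp add: True)
      moreover have "k mod N \<noteq> j mod N \<longleftrightarrow> k \<noteq> j" using True by (metis div_mult_mod_eq)
      ultimately show ?thesis
        using w[OF T(1), of "k mod N" "j mod N"] N True unfolding eq by (simp add: u_def v_def)
    next
      case False
      then have "bilin Mr Mt {..<T} h u v k j = 0" unfolding eq by (simp add: v_def)
      then show ?thesis using False by auto
    qed
  qed
  then show ?thesis unfolding N_def by blast
qed

text \<open>The probability-free core. The user bound also makes the achievable values finite in
  number, and \<open>K0\<close> users provide one, so \<open>Max\<close> is meaningful.\<close>

lemma generic_channel_dof:
  assumes Mt: "Mt \<ge> 1" and Mr: "Mr \<ge> 1" and T: "T \<ge> 1"
    and H: "\<And>k j. H k j = channel_matrix Mr Mt T (\<lambda>l p q. h (k, j, l, p, q))"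
    and indep: "alg_indep (UNIV \<times> UNIV \<times> {..<T} \<times> {..<Mr} \<times> {..<Mt}) h"
  shows "(\<forall>K\<ge>1. single_beam_feasible Mr Mt T H K \<longrightarrow> K \<le> (Mr + Mt) * T - 1) \<and>
      (\<forall>K. K = (Mr + Mt - 1) * T \<longrightarrow> single_beam_feasible Mr Mt T H K) \<and>
      (finite (achievable_dofs Mr Mt T H) \<and> achievable_dofs Mr Mt T H \<noteq> {} \<and>
       max_dof Mr Mt T H \<le> real (Mr + Mt) \<and> real (Mr + Mt) - 1 \<le> max_dof Mr Mt T H)"
proof -
  have upper: "K < (Mr + Mt) * T" if K: "K \<ge> 1" "single_beam_feasible Mr Mt T H K" for K
  proof -
    obtain u v where uv: "\<forall>k<K. \<forall>j<K. bilin Mr Mt {..<T} h u v k j = 0 \<longleftrightarrow> k \<noteq> j"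
      using K(2) single_beam_feasible_iff[OF H] by blast
    have "card {..<K} < (Mr + Mt) * card {..<T}"
      by (rule alignment_user_bound[OF _ _ _ indep, where u = u and v = v]) (use K(1) uv in \<open>auto simp: lessThan_empty_iff\<close>)
    then show ?thesis by simp
  qed
  define K0 where "K0 = (Mr + Mt - 1) * T"
  have lower: "single_beam_feasible Mr Mt T H K0"
    unfolding K0_def single_beam_feasible_iff[OF H] by (rule generic_block_alignment[OF Mr Mt indep])
  define A where "A = achievable_dofs Mr Mt T H"
  have "A \<subseteq> (\<lambda>K. real K / real T) ` {..<(Mr + Mt) * T}"
    using upper by (auto simp: A_def achievable_dofs_def)
  then have fin: "finite A" by (rule finite_subset) simp
  have "K0 \<ge> 1" using Mr Mt T by (simp add: K0_def)
  then have mem: "real K0 / real T \<in> A" using lower by (auto simp: A_def achievable_dofs_def)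
  have K0_eq: "real K0 / real T = real (Mr + Mt) - 1" using T Mr by (simp add: K0_def of_nat_diff)
  have "Max A \<le> real (Mr + Mt)"
  proof (rule Max.boundedI[OF fin])
    show "A \<noteq> {}" using mem by blast
    fix d assume "d \<in> A"
    then obtain K where d: "d = real K / real T" and "K < (Mr + Mt) * T"
      using upper by (auto simp: A_def achievable_dofs_def)
    then have "real K \<le> real ((Mr + Mt) * T)" by (simp only: of_nat_le_iff)
    then show "d \<le> real (Mr + Mt)" using T by (simp add: d field_simps)
  qed
  moreover have "real (Mr + Mt) - 1 \<le> Max A" using Max_ge[OF fin mem] K0_eq by simp
  moreover have "\<forall>K\<ge>1. single_beam_feasible Mr Mt T H K \<longrightarrow> K \<le> (Mr + Mt) * T - 1"
    using upper by fastforce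
  ultimately show ?thesis using lower fin mem unfolding max_dof_def A_def K0_def by blast
qed

theorem theorem3p1:
  fixes M :: "'a measure"
    and Mt Mr T :: nat
    and h :: "nat \<Rightarrow> nat \<Rightarrow> nat \<Rightarrow> nat \<Rightarrow> nat \<Rightarrow> 'a \<Rightarrow> complex"
    and H :: "'a \<Rightarrow> nat \<Rightarrow> nat \<Rightarrow> complex Matrix.mat"
  assumes "Mt \<ge> 1" and "Mr \<ge> 1" and "T \<ge> 1"
    and "prob_space M"
    and indep: "prob_space.indep_vars M (\<lambda>_. borel) (\<lambda>(k, j, l, p, q). h k j l p q)
           (UNIV \<times> UNIV \<times> {..<T} \<times> {..<Mr} \<times> {..<Mt})"
    and cont: "\<And>k j l p q. l < T \<Longrightarrow> p < Mr \<Longrightarrow> q < Mt \<Longrightarrow>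
           absolutely_continuous lborel (distr M borel (h k j l p q))"
    and H: "\<And>\<omega> k j. H \<omega> k j = channel_matrix Mr Mt T (\<lambda>l p q. h k j l p q \<omega>)"
  shows "AE \<omega> in M.
      (\<forall>K\<ge>1. single_beam_feasible Mr Mt T (H \<omega>) K \<longrightarrow> K \<le> (Mr + Mt) * T - 1) \<and>
      (\<forall>K. K = (Mr + Mt - 1) * T \<longrightarrow> single_beam_feasible Mr Mt T (H \<omega>) K) \<and>
      (finite (achievable_dofs Mr Mt T (H \<omega>)) \<and> achievable_dofs Mr Mt T (H \<omega>) \<noteq> {} \<and>
       max_dof Mr Mt T (H \<omega>) \<le> real (Mr + Mt) \<and>
       real (Mr + Mt) - 1 \<le> max_dof Mr Mt T (H \<omega>))"
proof -
  interpret prob_space M by fact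
  have "AE \<omega> in M. alg_indep (UNIV \<times> UNIV \<times> {..<T} \<times> {..<Mr} \<times> {..<Mt})
      (\<lambda>i. (\<lambda>(k, j, l, p, q). h k j l p q) i \<omega>)"
  proof (rule AE_alg_indep[OF indep])
    fix i :: "nat \<times> nat \<times> nat \<times> nat \<times> nat" and c :: complex
    assume "i \<in> UNIV \<times> UNIV \<times> {..<T} \<times> {..<Mr} \<times> {..<Mt}"
    then obtain k j l p q where i: "i = (k, j, l, p, q)" "l < T" "p < Mr" "q < Mt" by auto
    \<comment> \<open>Absolute continuity enters here: points are Lebesgue null, so the
      distributions have no atoms.\<close>
    have "{c} \<in> null_sets lborel" by (simp add: null_sets_def)
    then have "{c} \<in> null_sets (distr M borel (h k j l p q))"
      using cont[OF i(2-4)] unfolding absolutely_continuous_def by blast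
    then have "AE x in distr M borel (h k j l p q). x \<notin> {c}" by (rule AE_not_in)
    then show "AE x in distr M borel ((\<lambda>(k, j, l, p, q). h k j l p q) i). x \<noteq> c"
      unfolding i(1) prod.case by simp
  qed
  then show ?thesis
  proof (rule eventually_mono)
    fix \<omega>
    assume "alg_indep (UNIV \<times> UNIV \<times> {..<T} \<times> {..<Mr} \<times> {..<Mt}) (\<lambda>i. (\<lambda>(k, j, l, p, q). h k j l p q) i \<omega>)"
    then show "(\<forall>K\<ge>1. single_beam_feasible Mr Mt T (H \<omega>) K \<longrightarrow> K \<le> (Mr + Mt) * T - 1) \<and>
      (\<forall>K. K = (Mr + Mt - 1) * T \<longrightarrow> single_beam_feasible Mr Mt T (H \<omega>) K) \<and>
      (finite (achievable_dofs Mr Mt T (H \<omega>)) \<and> achievable_dofs Mr Mt T (H \<omega>) \<noteq> {} \<and>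
       max_dof Mr Mt T (H \<omega>) \<le> real (Mr + Mt) \<and>
       real (Mr + Mt) - 1 \<le> max_dof Mr Mt T (H \<omega>))"
      by (intro generic_channel_dof assms(1-3)) (simp_all add: H)
  qed
qed

end
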